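(* Let $f:\mathbb{R}^n\times\mathbb{R}^{n_u}\to\mathbb{R}^n$ (drift) and $g:\mathbb{R}^n\to\mathbb{R}^{n\times d}$ (diffusion) be smooth, let $V\subset\mathbb{R}^n$ be open, $\mathcal{U}\subset\mathbb{R}^{n_u}$, and $N=n+\frac{n(n+1)}{2}$. Let $\mathfrak{f}=\{f(\cdot,u):u\in\mathcal{U}\}$, as a family of vector fields on $V$, and let $\mathfrak{F}_g=\{F(\cdot,u):u\in\mathcal{U}\}$ be the family of vector fields on $V\times\mathrm{Sym}^+(n)$ given by $$F((m,P),u)=\begin{pmatrix} f(m,u)\\ D_xf(m,u)P+PD_xf(m,u)^\top+g(m)g(m)^\top\end{pmatrix}.$$ Then: 1. If for every $m\in V$ $$\dim\left\{\begin{pmatrix} h(m)\\ Dh(m)+Dh(m)^\top\end{pmatrix}:h\in\mathrm{Lie}(\mathfrak{f})\right\}=N,$$ then $\mathfrak{F}_g$ satisfies the accessibility rank condition on an open and dense subset of $V\times\mathrm{Sym}^+(n)$. 2. If for every $m\in V$ $$\dim\left\{\begin{pmatrix} h(m)\\ Dh(m)+Dh(m)^\top\end{pmatrix}:h\in\mathcal{I}(\mathfrak{f})\right\}=N,$$ then $\mathfrak{F}_g$ satisfies the accessibility rank condition in fixed time on an open and dense subset of $V\times\mathrm{Sym}^+(n)$.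
   Context: $\mathrm{Sym}(n)$ (resp. $\mathrm{Sym}^+(n)$) is the set of real symmetric (resp. symmetric positive definite) $n\times n$ matrices; $D_xf$ is the Jacobian of $f$ with respect to its first variable, $Dh$ the Jacobian of a vector field $h$. For a family $\mathfrak{f}$ of smooth vector fields on an open set, with Lie bracket $[h_1,h_2]=dh_2\cdot h_1-dh_1\cdot h_2$: $\mathrm{Lie}(\mathfrak{f})=\mathrm{span}\{[h_1,[\dots,[h_{k-1},h_k]\dots]]:k\ge1,\ h_i\in\mathfrak{f}\}$; $\mathcal{D}(\mathfrak{f})=\{[h_1,[\dots,[h_{k-1},h_k]\dots]]:k\ge2,\ h_i\in\mathfrak{f}\}$; zero-time ideal $\mathcal{I}(\mathfrak{f})=\mathrm{span}\{h_1-h_2,\ h_3:h_1,h_2\in\mathfrak{f},\ h_3\in\mathcal{D}(\mathfrak{f})\}$. The same definitions apply to $\mathfrak{F}_g$. For a point $X$, $\mathrm{Lie}_X(\mathfrak{F}_g)=\{F(X):F\in\mathrm{Lie}(\mathfrak{F}_g)\}$ and $\mathcal{I}_X(\mathfrak{F}_g)=\{F(X):F\in\mathcal{I}(\mathfrak{F}_g)\}$, subspaces of $\mathbb{R}^n\times\mathrm{Sym}(n)$, which has dimension $N$. $\mathfrak{F}_g$ satisfies the accessibility rank condition (resp. in fixed time) at $X$ if $\dim\mathrm{Lie}_X(\mathfrak{F}_g)=N$ (resp. $\dim\mathcal{I}_X(\mathfrak{F}_g)=N$); it satisfies it on a set if it does so at every point of the set. *)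

theory Defs
  imports "HOL-Analysis.Analysis" "HOL-Library.Function_Algebras"
begin

text \<open>The pointwise real vector space of functions; \<^const>\<open>span\<close> is used below for
  spans of vector fields.\<close>

instantiation "fun" :: (type, real_vector) real_vector
begin

definition scaleR_fun :: "real \<Rightarrow> ('a \<Rightarrow> 'b) \<Rightarrow> 'a \<Rightarrow> 'b" where
  "scaleR_fun c h = (\<lambda>x. c *\<^sub>R h x)"

instance
  by standard (simp_all add: scaleR_fun_def fun_eq_iff scaleR_add_right scaleR_add_left)

end

text \<open>For an open set \<open>S\<close>, \<open>Ck_on k S h\<close> says that \<open>h\<close> is \<open>k\<close> times continuously
  differentiable on \<open>S\<close>: all iterated directional derivatives of order at most \<open>k\<close> exist as
  values of Frechet derivatives and are continuous.\<close>

fun Ck_on :: "nat \<Rightarrow> 'a::real_normed_vector set \<Rightarrow> ('a \<Rightarrow> 'b::real_normed_vector) \<Rightarrow> bool" where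
  "Ck_on 0 S h \<longleftrightarrow> continuous_on S h"
| "Ck_on (Suc k) S h \<longleftrightarrow>
     (\<forall>x\<in>S. h differentiable (at x)) \<and>
     (\<forall>v. Ck_on k S (\<lambda>x. frechet_derivative h (at x) v))"

definition smooth_on :: "'a::real_normed_vector set \<Rightarrow> ('a \<Rightarrow> 'b::real_normed_vector) \<Rightarrow> bool" where
  "smooth_on S h \<longleftrightarrow> (\<forall>k. Ck_on k S h)"

text \<open>A vector field on \<open>S\<close> is a total function of which only the values on \<open>S\<close> matter. The set
  \<open>S\<close> is open in some linear subspace \<open>E\<close> of the ambient space, and the vector fields take
  values in \<open>E\<close> on \<open>S\<close>: for \<open>S = V\<close> open in \<open>real^'n\<close>, \<open>E\<close> is the whole space; for
  \<open>S = V \<times> sym_posdef\<close> below, \<open>E\<close> is the product of \<open>real^'n\<close> with the symmetric matrices.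
  Derivatives are therefore taken within \<open>S\<close>. A derivative within \<open>S\<close> is uniquely determined on
  \<open>E\<close>, and the bracket only applies it to vectors of \<open>E\<close>, so on \<open>S\<close> the bracket is the
  usual one of vector fields on an open subset of \<open>E\<close>; it does not depend on the values of the
  fields outside \<open>S\<close>.\<close>

definition lie_bracket ::
  "'a::real_normed_vector set \<Rightarrow> ('a \<Rightarrow> 'a) \<Rightarrow> ('a \<Rightarrow> 'a) \<Rightarrow> 'a \<Rightarrow> 'a" where
  "lie_bracket S h1 h2 x =
     frechet_derivative h2 (at x within S) (h1 x) - frechet_derivative h1 (at x within S) (h2 x)"

text \<open>\<open>nested_bracket S [h\<^sub>1, \<dots>, h\<^sub>k]\<close> is \<open>[h\<^sub>1, [\<dots>, [h\<^bsub>k-1\<^esub>, h\<^sub>k]\<dots>]]\<close>; the value for the empty list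
  is irrelevant.\<close>

fun nested_bracket :: "'a::real_normed_vector set \<Rightarrow> ('a \<Rightarrow> 'a) list \<Rightarrow> 'a \<Rightarrow> 'a" where
  "nested_bracket S [] = (\<lambda>_. 0)"
| "nested_bracket S [h] = h"
| "nested_bracket S (h # h' # hs) = lie_bracket S h (nested_bracket S (h' # hs))"

definition Lie :: "'a::real_normed_vector set \<Rightarrow> ('a \<Rightarrow> 'a) set \<Rightarrow> ('a \<Rightarrow> 'a) set" where
  "Lie S \<F> = span {nested_bracket S hs |hs. length hs \<ge> 1 \<and> set hs \<subseteq> \<F>}"

definition derived_brackets ::
  "'a::real_normed_vector set \<Rightarrow> ('a \<Rightarrow> 'a) set \<Rightarrow> ('a \<Rightarrow> 'a) set" where
  "derived_brackets S \<F> = {nested_bracket S hs |hs. length hs \<ge> 2 \<and> set hs \<subseteq> \<F>}"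

definition zero_time_ideal ::
  "'a::real_normed_vector set \<Rightarrow> ('a \<Rightarrow> 'a) set \<Rightarrow> ('a \<Rightarrow> 'a) set" where
  "zero_time_ideal S \<F> =
     span ({h1 - h2 |h1 h2. h1 \<in> \<F> \<and> h2 \<in> \<F>} \<union> derived_brackets S \<F>)"

definition sym_posdef :: "(real^'n^'n) set" where
  "sym_posdef = {P. transpose P = P \<and> (\<forall>x. x \<noteq> 0 \<longrightarrow> x \<bullet> (P *v x) > 0)}"

text \<open>The dimension of \<open>real^'n\<close> times the symmetric matrices.\<close>

definition state_dim :: "'n::finite itself \<Rightarrow> nat" where
  "state_dim _ = CARD('n) + CARD('n) * (CARD('n) + 1) div 2"

definition accessibility_rank ::
  "((real^'n) \<times> (real^'n^'n)) set \<Rightarrow>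
   ((real^'n) \<times> (real^'n^'n) \<Rightarrow> (real^'n) \<times> (real^'n^'n)) set \<Rightarrow>
   (real^'n) \<times> (real^'n^'n) \<Rightarrow> bool" where
  "accessibility_rank S \<F> X \<longleftrightarrow> dim {F X |F. F \<in> Lie S \<F>} = state_dim TYPE('n)"

definition accessibility_rank_fixed_time ::
  "((real^'n) \<times> (real^'n^'n)) set \<Rightarrow>
   ((real^'n) \<times> (real^'n^'n) \<Rightarrow> (real^'n) \<times> (real^'n^'n)) set \<Rightarrow>
   (real^'n) \<times> (real^'n^'n) \<Rightarrow> bool" where
  "accessibility_rank_fixed_time S \<F> X \<longleftrightarrow>
     dim {F X |F. F \<in> zero_time_ideal S \<F>} = state_dim TYPE('n)"

definition mean_cov_field ::
  "((real^'n) \<times> (real^'u) \<Rightarrow> real^'n) \<Rightarrow> (real^'n \<Rightarrow> real^'d^'n) \<Rightarrow> real^'u \<Rightarrow>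
   (real^'n) \<times> (real^'n^'n) \<Rightarrow> (real^'n) \<times> (real^'n^'n)" where
  "mean_cov_field f g u = (\<lambda>(m, P).
     let A = jacobian (\<lambda>x. f (x, u)) (at m)
     in (f (m, u), A ** P + P ** transpose A + g m ** transpose (g m)))"

end

theory Submission
  imports Defs
begin

text \<open>
  Every iterated bracket of the fields \<open>F(\<cdot>, u)\<close> has the form
  \<open>(m, P) \<mapsto> (h(m), Dh(m) P + P Dh(m)\<^sup>T + R(m))\<close>, where \<open>h\<close> is the corresponding bracket of the
  drifts and \<open>R\<close> is a symmetric matrix depending on \<open>m\<close> only. The bracket of two such fields is again
  one, because the terms of the form \<open>A P B\<^sup>T + B P A\<^sup>T\<close> cancel and because the symmetry of second
  derivatives identifies the remaining coefficient of \<open>P\<close> as the Jacobian of the bracket of the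
  drifts (\<open>jacobian_lie_bracket\<close>, \<open>lifts_lie_bracket\<close>). The form is preserved by linear combinations, so
  it holds on the whole Lie algebra and on the zero-time ideal (\<open>lifted_families\<close>).

  Fix \<open>m\<close> and choose \<open>N\<close> drift brackets whose vectors \<open>(h(m), Dh(m) + Dh(m)\<^sup>T)\<close> are independent. At
  \<open>P = \<lambda> I\<close> the lifted values are, after division of the second component by \<open>\<lambda>\<close>, equal to these
  vectors plus \<open>(0, R(m) / \<lambda>)\<close>, hence independent for all but finitely many \<open>\<lambda> > 0\<close>. Along the segment from
  \<open>\<lambda> I\<close> to an arbitrary positive definite \<open>P0\<close> the values are affine in the parameter, so they stay
  independent except at finitely many points (\<open>finite_singular_pencil\<close>), and the points of full rank
  accumulate at \<open>P0\<close> (\<open>full_rank_dense\<close>). The rank never exceeds \<open>N\<close>, since all values have a symmetric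
  second component, and having rank at least \<open>N\<close> is an open condition (\<open>openin_full_rank\<close>). So the set
  of all points of full rank is open and dense in the state space.

  The positive definite matrices are not open in the space of all matrices, and derivatives within
  the state space are determined only on symmetric directions. This suffices: brackets differentiate
  in the direction of other fields of the family, which are symmetric in the second component
  (\<open>frechet_derivative_within_state_space\<close>).
\<close>

section \<open>Calculus of smooth maps\<close>


lemma Ck_on_cong:
  assumes "open S" "\<And>x. x \<in> S \<Longrightarrow> f x = h x" "Ck_on k S f"
  shows "Ck_on k S h"
  using assms(2,3)
proof (induction k arbitrary: f h)
  case 0
  then show ?case by (simp cong: continuous_on_cong)
next
  case (Suc k)
  have D: "(h has_derivative frechet_derivative f (at x)) (at x)" if "x \<in> S" for x
    using Suc.prems that assms(1)
    by (auto simp: frechet_derivative_works intro: has_derivative_transform_within_open)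
  have E: "frechet_derivative h (at x) = frechet_derivative f (at x)" if "x \<in> S" for x
    using D[OF that] frechet_derivative_at by metis
  have "Ck_on k S (\<lambda>x. frechet_derivative h (at x) v)" for v
    by (rule Suc.IH[of "\<lambda>x. frechet_derivative f (at x) v"]) (use Suc.prems E in auto)
  then show ?case using D by (auto simp: differentiable_def)
qed

lemma Ck_on_SucD: "Ck_on (Suc k) S h \<Longrightarrow> Ck_on k S h"
proof (induction k arbitrary: h)
  case 0
  then show ?case
    by (auto intro!: continuous_at_imp_continuous_on differentiable_imp_continuous_within)
qed auto

lemma Ck_on_subset: "Ck_on k T h \<Longrightarrow> S \<subseteq> T \<Longrightarrow> Ck_on k S h"
  by (induction k arbitrary: h) (auto intro: continuous_on_subset)

lemma Ck_on_const: "Ck_on k S (\<lambda>x. c)"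
  by (induction k arbitrary: c) (auto simp: frechet_derivative_const)

text \<open>The inductive step for all closure properties: it accepts a formula \<open>h'\<close> for the derivative
  on \<open>S\<close> in place of \<^const>\<open>frechet_derivative\<close>. Openness of \<open>S\<close> is what makes a formula that holds
  only on \<open>S\<close> differentiable in its turn.\<close>

lemma Ck_on_Suc_I:
  assumes "open S" "\<And>x. x \<in> S \<Longrightarrow> (h has_derivative h' x) (at x)"
    and "\<And>v. Ck_on k S (\<lambda>x. h' x v)"
  shows "Ck_on (Suc k) S h"
proof -
  have "frechet_derivative h (at x) = h' x" if "x \<in> S" for x
    using assms(2)[OF that] frechet_derivative_at by metis
  then have "Ck_on k S (\<lambda>x. frechet_derivative h (at x) v)" for v
    using Ck_on_cong[OF assms(1) _ assms(3)[of v]] by force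
  then show ?thesis using assms(2) by (auto simp: differentiable_def)
qed

lemma Ck_on_add:
  assumes "open S"
  shows "Ck_on k S f \<Longrightarrow> Ck_on k S h \<Longrightarrow> Ck_on k S (\<lambda>x. f x + h x)"
proof (induction k arbitrary: f h)
  case 0
  then show ?case by (auto intro: continuous_intros)
next
  case (Suc k)
  show ?case
    by (rule Ck_on_Suc_I[OF assms, where h' = "\<lambda>x v. frechet_derivative f (at x) v + frechet_derivative h (at x) v"])
       (use Suc in \<open>auto intro!: has_derivative_add simp: frechet_derivative_works\<close>)
qed

lemma Ck_on_bilinear:
  assumes "open S" and b: "bounded_bilinear p"
  shows "Ck_on k S f \<Longrightarrow> Ck_on k S h \<Longrightarrow> Ck_on k S (\<lambda>x. p (f x) (h x))"
proof (induction k arbitrary: f h)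
  case 0
  then show ?case by (auto intro: bounded_bilinear.continuous_on[OF b])
next
  case (Suc k)
  note low = Suc.prems[THEN Ck_on_SucD]
  show ?case
  proof (rule Ck_on_Suc_I[OF assms(1)])
    fix x assume "x \<in> S"
    then show "((\<lambda>x. p (f x) (h x)) has_derivative (\<lambda>v. p (f x) (frechet_derivative h (at x) v)
        + p (frechet_derivative f (at x) v) (h x))) (at x)"
      using Suc.prems by (intro bounded_bilinear.FDERIV[OF b]) (auto simp: frechet_derivative_works)
  next
    fix v
    show "Ck_on k S (\<lambda>x. p (f x) (frechet_derivative h (at x) v) + p (frechet_derivative f (at x) v) (h x))"
      using Suc.prems low by (intro Ck_on_add[OF assms(1)] Suc.IH) auto
  qed
qed

lemma Ck_on_linear:
  assumes "open S" and b: "bounded_linear p"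
  shows "Ck_on k S f \<Longrightarrow> Ck_on k S (\<lambda>x. p (f x))"
proof (induction k arbitrary: f)
  case 0
  then show ?case by (auto intro: bounded_linear.continuous_on[OF b])
next
  case (Suc k)
  show ?case
    by (rule Ck_on_Suc_I[OF assms(1), where h' = "\<lambda>x v. p (frechet_derivative f (at x) v)"])
       (use Suc in \<open>auto intro!: bounded_linear.has_derivative[OF b] simp: frechet_derivative_works\<close>)
qed

lemma Ck_on_fix_snd:
  assumes "open V"
  shows "Ck_on k UNIV f \<Longrightarrow> Ck_on k V (\<lambda>x. f (x, u))"
proof (induction k arbitrary: f)
  case 0
  then show ?case
    by (auto intro!: continuous_intros continuous_on_compose2[of UNIV f])
next
  case (Suc k)
  have "((\<lambda>x. f (x, u)) has_derivative (\<lambda>v. frechet_derivative f (at (x, u)) (v, 0))) (at x)" for x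
  proof -
    have "(f has_derivative frechet_derivative f (at (x, u))) (at (x, u))"
      using Suc.prems by (simp add: frechet_derivative_works)
    moreover have "((\<lambda>x. (x, u)) has_derivative (\<lambda>v. (v, 0))) (at x)"
      by (auto intro!: derivative_eq_intros)
    ultimately show ?thesis by (rule has_derivative_compose[rotated])
  qed
  then show ?case
    using Suc.prems
    by (intro Ck_on_Suc_I[OF assms, where h' = "\<lambda>x v. frechet_derivative f (at (x, u)) (v, 0)"]
        Suc.IH[of "\<lambda>y. frechet_derivative f (at y) (_, 0)"]) auto
qed

lemma smooth_on_continuous: "smooth_on S h \<Longrightarrow> continuous_on S h"
  unfolding smooth_on_def by (metis Ck_on.simps(1))

lemma smooth_on_has_derivative:
  "smooth_on S h \<Longrightarrow> x \<in> S \<Longrightarrow> (h has_derivative frechet_derivative h (at x)) (at x)"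
  unfolding smooth_on_def by (metis Ck_on.simps(2) frechet_derivative_works)

lemma smooth_on_directional: "smooth_on S h \<Longrightarrow> smooth_on S (\<lambda>x. frechet_derivative h (at x) v)"
  unfolding smooth_on_def by (metis Ck_on.simps(2))

lemma smooth_on_const: "smooth_on S (\<lambda>x. c)"
  by (simp add: smooth_on_def Ck_on_const)

lemma smooth_on_cong: "open S \<Longrightarrow> smooth_on S f \<Longrightarrow> (\<And>x. x \<in> S \<Longrightarrow> f x = h x) \<Longrightarrow> smooth_on S h"
  unfolding smooth_on_def using Ck_on_cong by blast

lemma smooth_on_add: "open S \<Longrightarrow> smooth_on S f \<Longrightarrow> smooth_on S h \<Longrightarrow> smooth_on S (\<lambda>x. f x + h x)"
  by (simp add: smooth_on_def Ck_on_add)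

lemma smooth_on_linear: "open S \<Longrightarrow> bounded_linear p \<Longrightarrow> smooth_on S f \<Longrightarrow> smooth_on S (\<lambda>x. p (f x))"
  by (simp add: smooth_on_def Ck_on_linear)

lemma smooth_on_bilinear:
  "open S \<Longrightarrow> bounded_bilinear p \<Longrightarrow> smooth_on S f \<Longrightarrow> smooth_on S h \<Longrightarrow> smooth_on S (\<lambda>x. p (f x) (h x))"
  by (simp add: smooth_on_def Ck_on_bilinear)

lemma smooth_on_diff:
  assumes "open S" "smooth_on S f" "smooth_on S h"
  shows "smooth_on S (\<lambda>x. f x - h x)"
  using smooth_on_add[OF assms(1,2) smooth_on_linear[OF assms(1) bounded_linear_minus[OF bounded_linear_ident] assms(3)]]
  by simp

lemma smooth_on_sum:
  "open S \<Longrightarrow> (\<And>i. i \<in> I \<Longrightarrow> smooth_on S (f i)) \<Longrightarrow> smooth_on S (\<lambda>x. \<Sum>i\<in>I. f i x)"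
  by (induction I rule: infinite_finite_induct) (auto intro: smooth_on_const smooth_on_add)

section \<open>Symmetry of second derivatives\<close>

text \<open>Two applications of the mean value theorem, in direction \<open>v\<close> and then in direction \<open>w\<close>. The
  left-hand side is symmetric in \<open>v\<close> and \<open>w\<close>, so exchanging them evaluates the same second
  difference by the other mixed derivative, at another nearby point.\<close>

lemma second_difference_eq:
  fixes \<phi> :: "'a::real_normed_vector \<Rightarrow> real"
  assumes s: "smooth_on V \<phi>" and V: "ball x \<delta> \<subseteq> V" and t: "t > 0" "t * (norm v + norm w) < \<delta>"
  shows "\<exists>y. dist x y \<le> t * (norm v + norm w) \<and>
    \<phi> (x + t *\<^sub>R v + t *\<^sub>R w) - \<phi> (x + t *\<^sub>R v) - \<phi> (x + t *\<^sub>R w) + \<phi> x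
      = t * (t * frechet_derivative (\<lambda>z. frechet_derivative \<phi> (at z) v) (at y) w)"
proof -
  have near: "dist x (x + a *\<^sub>R v + b *\<^sub>R w) \<le> t * (norm v + norm w)"
    if "0 \<le> a" "a \<le> t" "0 \<le> b" "b \<le> t" for a b
  proof -
    have "dist x (x + a *\<^sub>R v + b *\<^sub>R w) = norm (a *\<^sub>R v + b *\<^sub>R w)"
      by (metis add.assoc add_diff_cancel_left' dist_norm norm_minus_commute)
    also have "\<dots> \<le> a * norm v + b * norm w"
      using norm_triangle_ineq[of "a *\<^sub>R v" "b *\<^sub>R w"] that by simp
    also have "\<dots> \<le> t * norm v + t * norm w"
      using that by (intro add_mono mult_right_mono) auto
    finally show ?thesis by (simp add: algebra_simps)
  qed
  have inV: "x + a *\<^sub>R v + b *\<^sub>R w \<in> V" if "0 \<le> a" "a \<le> t" "0 \<le> b" "b \<le> t" for a b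
    using near[OF that] t V by (auto simp: subset_iff)
  have der: "((\<lambda>r. \<psi> (z + r *\<^sub>R e)) has_real_derivative frechet_derivative \<psi> (at (z + a *\<^sub>R e)) e) (at a)"
    if "smooth_on V \<psi>" "z + a *\<^sub>R e \<in> V" for z e a and \<psi> :: "'a \<Rightarrow> real"
  proof -
    have D: "(\<psi> has_derivative frechet_derivative \<psi> (at (z + a *\<^sub>R e))) (at (z + a *\<^sub>R e))"
      by (rule smooth_on_has_derivative[OF that])
    have "((\<lambda>r. z + r *\<^sub>R e) has_derivative (\<lambda>r. r *\<^sub>R e)) (at a)"
      by (auto intro!: derivative_eq_intros)
    from has_derivative_compose[OF this D]
    have "((\<lambda>r. \<psi> (z + r *\<^sub>R e)) has_derivative (\<lambda>r. frechet_derivative \<psi> (at (z + a *\<^sub>R e)) (r *\<^sub>R e))) (at a)" .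
    moreover have "(\<lambda>r. frechet_derivative \<psi> (at (z + a *\<^sub>R e)) (r *\<^sub>R e)) = (*) (frechet_derivative \<psi> (at (z + a *\<^sub>R e)) e)"
      using linear_scale[OF has_derivative_linear[OF D]] by (auto simp: mult.commute)
    ultimately show ?thesis by (simp add: has_field_derivative_def)
  qed
  let ?D = "\<lambda>z. frechet_derivative \<phi> (at z) v"
  have "\<exists>\<xi>>0. \<xi> < t \<and> (\<phi> ((x + t *\<^sub>R w) + t *\<^sub>R v) - \<phi> (x + t *\<^sub>R v))
       - (\<phi> ((x + t *\<^sub>R w) + 0 *\<^sub>R v) - \<phi> (x + 0 *\<^sub>R v))
     = (t - 0) * (?D ((x + t *\<^sub>R w) + \<xi> *\<^sub>R v) - ?D (x + \<xi> *\<^sub>R v))"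
  proof (rule MVT2[OF t(1)])
    fix a assume a: "0 \<le> a" "a \<le> t"
    show "((\<lambda>a. \<phi> ((x + t *\<^sub>R w) + a *\<^sub>R v) - \<phi> (x + a *\<^sub>R v)) has_real_derivative
       (?D ((x + t *\<^sub>R w) + a *\<^sub>R v) - ?D (x + a *\<^sub>R v))) (at a)"
      using inV[OF a, of t] inV[OF a, of 0] t(1)
      by (intro DERIV_diff der[OF s]) (simp_all add: algebra_simps)
  qed
  then obtain \<xi> where \<xi>: "\<xi> > 0" "\<xi> < t"
    "\<phi> (x + t *\<^sub>R v + t *\<^sub>R w) - \<phi> (x + t *\<^sub>R v) - \<phi> (x + t *\<^sub>R w) + \<phi> x
      = t * (?D (x + \<xi> *\<^sub>R v + t *\<^sub>R w) - ?D (x + \<xi> *\<^sub>R v + 0 *\<^sub>R w))"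
    by (force simp: algebra_simps)
  have "\<exists>\<eta>>0. \<eta> < t \<and> ?D (x + \<xi> *\<^sub>R v + t *\<^sub>R w) - ?D (x + \<xi> *\<^sub>R v + 0 *\<^sub>R w)
     = (t - 0) * frechet_derivative ?D (at (x + \<xi> *\<^sub>R v + \<eta> *\<^sub>R w)) w"
    by (rule MVT2[OF t(1)]) (use inV \<xi> in \<open>auto intro!: der smooth_on_directional s\<close>)
  then obtain \<eta> where \<eta>: "\<eta> > 0" "\<eta> < t" "?D (x + \<xi> *\<^sub>R v + t *\<^sub>R w) - ?D (x + \<xi> *\<^sub>R v + 0 *\<^sub>R w)
     = t * frechet_derivative ?D (at (x + \<xi> *\<^sub>R v + \<eta> *\<^sub>R w)) w"
    by auto
  show ?thesis
    using near[of \<xi> \<eta>] \<xi> \<eta> by (intro exI[of _ "x + \<xi> *\<^sub>R v + \<eta> *\<^sub>R w"]) auto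
qed

text \<open>The two mixed derivatives agree at pairs of points that both tend to \<open>x\<close>, hence at \<open>x\<close> by
  continuity.\<close>

lemma second_derivative_symmetric_real:
  fixes \<phi> :: "'a::real_normed_vector \<Rightarrow> real"
  assumes s: "smooth_on V \<phi>" and V: "open V" "x \<in> V"
  shows "frechet_derivative (\<lambda>z. frechet_derivative \<phi> (at z) v) (at x) w =
         frechet_derivative (\<lambda>z. frechet_derivative \<phi> (at z) w) (at x) v"
proof -
  let ?D = "\<lambda>v w x. frechet_derivative (\<lambda>z. frechet_derivative \<phi> (at z) v) (at x) w"
  obtain \<delta> where \<delta>: "\<delta> > 0" "ball x \<delta> \<subseteq> V" using V openE by blast
  define C where "C = norm v + norm w + 1"
  have C: "C > 0" by (simp add: C_def add_nonneg_pos)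
  \<comment> \<open>Step sizes that tend to zero and keep all four corners of the parallelogram in the ball.\<close>
  define t where "t n = \<delta> / (C * real (Suc (Suc n)))" for n :: nat
  have t: "t n > 0" "t n * C < \<delta>" for n
  proof -
    show "t n > 0" using C \<delta> by (simp add: t_def)
    have "t n * C = \<delta> / real (Suc (Suc n))" using C by (simp add: t_def)
    also have "\<dots> < \<delta> / 1" using \<delta> by (intro divide_strict_left_mono) auto
    finally show "t n * C < \<delta>" by simp
  qed
  have tC: "t n * (norm v + norm w) \<le> t n * C" for n
    using t(1)[of n] by (simp add: C_def)
  have tlim: "(\<lambda>n. t n * C) \<longlonglongrightarrow> 0"
  proof -
    have "(\<lambda>n. \<delta> * inverse (real (Suc (Suc n)))) \<longlonglongrightarrow> \<delta> * 0"
      by (intro tendsto_intros LIMSEQ_Suc[OF LIMSEQ_inverse_real_of_nat])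
    moreover have "t n * C = \<delta> * inverse (real (Suc (Suc n)))" for n
      using C by (simp add: t_def divide_inverse)
    ultimately show ?thesis by simp
  qed
  have "\<exists>y y'. dist y x \<le> t n * C \<and> dist y' x \<le> t n * C \<and> ?D v w y = ?D w v y'" for n
  proof -
    have *: "t n * (norm v + norm w) < \<delta>" "t n * (norm w + norm v) < \<delta>"
      using tC[of n] t(2)[of n] by (auto simp: add.commute)
    from second_difference_eq[OF s \<delta>(2) t(1) *(1)] obtain y where y: "dist x y \<le> t n * (norm v + norm w)"
      "\<phi> (x + t n *\<^sub>R v + t n *\<^sub>R w) - \<phi> (x + t n *\<^sub>R v) - \<phi> (x + t n *\<^sub>R w) + \<phi> x = t n * (t n * ?D v w y)"
      by blast
    from second_difference_eq[OF s \<delta>(2) t(1) *(2)] obtain y' where y': "dist x y' \<le> t n * (norm w + norm v)"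
      "\<phi> (x + t n *\<^sub>R w + t n *\<^sub>R v) - \<phi> (x + t n *\<^sub>R w) - \<phi> (x + t n *\<^sub>R v) + \<phi> x = t n * (t n * ?D w v y')"
      by blast
    have "t n * (t n * ?D v w y) = t n * (t n * ?D w v y')"
      using y(2) y'(2) by (simp add: algebra_simps)
    then have "?D v w y = ?D w v y'" using t(1)[of n] by simp
    moreover have "dist y x \<le> t n * C" "dist y' x \<le> t n * C"
      using order_trans[OF y(1) tC] order_trans[OF y'(1)] tC[of n]
      by (auto simp: dist_commute add.commute)
    ultimately show ?thesis by blast
  qed
  then obtain y y' where y: "\<And>n. dist (y n) x \<le> t n * C" "\<And>n. dist (y' n) x \<le> t n * C"
    "\<And>n. ?D v w (y n) = ?D w v (y' n)" by metis
  have lim: "y \<longlonglongrightarrow> x" "y' \<longlonglongrightarrow> x"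
    using y(1,2) by (auto intro!: metric_tendsto_imp_tendsto[OF tlim] always_eventually simp: t(1) C less_imp_le)
  have cont: "isCont (?D v w) x" for v w
    using smooth_on_continuous[OF smooth_on_directional[OF smooth_on_directional[OF s]]] V
      continuous_on_eq_continuous_at by blast
  have "(\<lambda>n. ?D v w (y n)) \<longlonglongrightarrow> ?D v w x" "(\<lambda>n. ?D w v (y' n)) \<longlonglongrightarrow> ?D w v x"
    by (auto intro!: isCont_tendsto_compose[OF cont] lim)
  then show ?thesis using y(3) LIMSEQ_unique by auto
qed

lemma second_derivative_symmetric:
  fixes h :: "'a::real_normed_vector \<Rightarrow> 'b::euclidean_space"
  assumes s: "smooth_on V h" and V: "open V" "x \<in> V"
  shows "frechet_derivative (\<lambda>z. frechet_derivative h (at z) v) (at x) w =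
         frechet_derivative (\<lambda>z. frechet_derivative h (at z) w) (at x) v"
proof (rule euclidean_eqI)
  fix b :: 'b
  have D: "frechet_derivative (\<lambda>z. k z \<bullet> b) (at z) = (\<lambda>v. frechet_derivative k (at z) v \<bullet> b)"
    if "smooth_on V k" "z \<in> V" for k :: "'a \<Rightarrow> 'b" and z
    by (rule frechet_derivative_at[symmetric]) (intro has_derivative_inner_left smooth_on_has_derivative[OF that])
  have D2: "frechet_derivative (\<lambda>z. frechet_derivative h (at z) v) (at x) w \<bullet> b
      = frechet_derivative (\<lambda>z. frechet_derivative (\<lambda>z. h z \<bullet> b) (at z) v) (at x) w" for v w
  proof -
    have "((\<lambda>z. frechet_derivative h (at z) v \<bullet> b) has_derivative
        (\<lambda>w. frechet_derivative (\<lambda>z. frechet_derivative h (at z) v) (at x) w \<bullet> b)) (at x)"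
      by (intro has_derivative_inner_left smooth_on_has_derivative[OF _ V(2)] smooth_on_directional s)
    then have "((\<lambda>z. frechet_derivative (\<lambda>z. h z \<bullet> b) (at z) v) has_derivative
        (\<lambda>w. frechet_derivative (\<lambda>z. frechet_derivative h (at z) v) (at x) w \<bullet> b)) (at x)"
      by (rule has_derivative_transform_within_open[OF _ V]) (simp add: D[OF s])
    from frechet_derivative_at[OF this] show ?thesis by metis
  qed
  show "frechet_derivative (\<lambda>z. frechet_derivative h (at z) v) (at x) w \<bullet> b =
    frechet_derivative (\<lambda>z. frechet_derivative h (at z) w) (at x) v \<bullet> b"
    unfolding D2
    by (rule second_derivative_symmetric_real[OF smooth_on_linear[OF V(1) bounded_linear_inner_left s] V])
qed

section \<open>Matrix algebra as bounded bilinear maps\<close>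


lemma bounded_bilinear_matrix_mult:
  "bounded_bilinear ((**) :: real^'b^'a \<Rightarrow> real^'c^'b \<Rightarrow> real^'c^'a)"
  unfolding bilinear_conv_bounded_bilinear[symmetric] bilinear_def
  by (auto intro!: linearI simp: matrix_matrix_mult_def vec_eq_iff sum.distrib sum_distrib_left algebra_simps)

lemma bounded_bilinear_matrix_vector_mult:
  "bounded_bilinear ((*v) :: real^'b^'a \<Rightarrow> real^'b \<Rightarrow> real^'a)"
  unfolding bilinear_conv_bounded_bilinear[symmetric] bilinear_def
  by (auto intro!: linearI simp: matrix_vector_mult_def vec_eq_iff sum.distrib sum_distrib_left algebra_simps)

lemma bounded_linear_transpose: "bounded_linear (transpose :: real^'b^'a \<Rightarrow> real^'a^'b)"
  unfolding linear_conv_bounded_linear[symmetric]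
  by (auto intro!: linearI simp: transpose_def vec_eq_iff)

lemmas matrix_mult_lin =
  bounded_bilinear.add_left[OF bounded_bilinear_matrix_mult]
  bounded_bilinear.add_right[OF bounded_bilinear_matrix_mult]
  bounded_bilinear.diff_left[OF bounded_bilinear_matrix_mult]
  bounded_bilinear.diff_right[OF bounded_bilinear_matrix_mult]
  bounded_bilinear.scaleR_left[OF bounded_bilinear_matrix_mult]
  bounded_bilinear.scaleR_right[OF bounded_bilinear_matrix_mult]

lemmas transpose_lin =
  linear_add[OF bounded_linear.linear[OF bounded_linear_transpose]]
  linear_diff[OF bounded_linear.linear[OF bounded_linear_transpose]]
  linear_scale[OF bounded_linear.linear[OF bounded_linear_transpose]]

section \<open>Jacobians and their derivatives\<close>

text \<open>Smoothness is defined through derivatives in constant directions; a direction \<open>k x\<close> that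
  varies with the point is reduced to these by expanding it in the standard basis.\<close>

lemma smooth_on_derivative_apply:
  fixes h :: "'a::euclidean_space \<Rightarrow> 'b::real_normed_vector"
  assumes "open S" "smooth_on S h" "smooth_on S k"
  shows "smooth_on S (\<lambda>x. frechet_derivative h (at x) (k x))"
proof (rule smooth_on_cong[OF assms(1)])
  show "smooth_on S (\<lambda>x. \<Sum>b\<in>Basis. (k x \<bullet> b) *\<^sub>R frechet_derivative h (at x) b)"
    by (intro smooth_on_sum smooth_on_bilinear[OF _ bounded_bilinear_scaleR]
        smooth_on_linear[OF _ bounded_linear_inner_left] smooth_on_directional assms)
next
  fix x assume "x \<in> S"
  then have "linear (frechet_derivative h (at x))"
    using smooth_on_has_derivative[OF assms(2)] has_derivative_linear by blast
  then have "frechet_derivative h (at x) (\<Sum>b\<in>Basis. (k x \<bullet> b) *\<^sub>R b)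
      = (\<Sum>b\<in>Basis. (k x \<bullet> b) *\<^sub>R frechet_derivative h (at x) b)"
    by (simp add: linear_sum linear_scale)
  then show "(\<Sum>b\<in>Basis. (k x \<bullet> b) *\<^sub>R frechet_derivative h (at x) b) = frechet_derivative h (at x) (k x)"
    by (simp add: euclidean_representation)
qed

lemma smooth_on_jacobian:
  fixes h :: "real^'n \<Rightarrow> real^'m"
  assumes "open S" "smooth_on S h"
  shows "smooth_on S (\<lambda>x. jacobian h (at x))"
proof -
  \<comment> \<open>\<open>L j\<close> puts a vector into column \<open>j\<close> of a zero matrix.\<close>
  define L :: "'n \<Rightarrow> real^'m \<Rightarrow> real^'n^'m" where "L j v = (\<chi> i k. if k = j then v $ i else 0)" for j v
  have L: "bounded_linear (L j)" for j
    unfolding linear_conv_bounded_linear[symmetric]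
    by (auto intro!: linearI simp: L_def vec_eq_iff)
  have "jacobian h (at x) = (\<Sum>j\<in>UNIV. L j (frechet_derivative h (at x) (axis j 1)))" for x
    by (simp add: jacobian_def matrix_def L_def vec_eq_iff)
  then show ?thesis
    using smooth_on_sum[OF assms(1) smooth_on_linear[OF assms(1) L smooth_on_directional[OF assms(2)]]]
    by simp
qed

abbreviation jacobian_derivative :: "(real^'n \<Rightarrow> real^'m) \<Rightarrow> real^'n \<Rightarrow> real^'n \<Rightarrow> real^'n^'m" where
  "jacobian_derivative h x \<equiv> frechet_derivative (\<lambda>z. jacobian h (at z)) (at x)"

lemma jacobian_mult:
  fixes h :: "real^'n \<Rightarrow> real^'m"
  assumes "smooth_on S h" "x \<in> S"
  shows "jacobian h (at x) *v v = frechet_derivative h (at x) v"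
proof -
  have "(h has_derivative (*v) (jacobian h (at x))) (at x)"
    using smooth_on_has_derivative[OF assms] differentiableI jacobian_works by blast
  from fun_cong[OF frechet_derivative_at[OF this], of v] show ?thesis .
qed

lemma jacobian_eqI:
  fixes h :: "real^'n \<Rightarrow> real^'m"
  assumes "(h has_derivative (\<lambda>v. A *v v)) (at x)"
  shows "jacobian h (at x) = A"
  unfolding jacobian_def frechet_derivative_at[OF assms, symmetric] by (rule matrix_of_matrix_vector_mul)

text \<open>Both sides are second derivatives of \<open>h\<close>, so this is the symmetry of second derivatives. It
  lets the direction of differentiation be factored out of the Jacobian of a bracket.\<close>

lemma jacobian_derivative_symmetric:
  fixes h :: "real^'n \<Rightarrow> real^'m"
  assumes "open S" "smooth_on S h" "x \<in> S"
  shows "jacobian_derivative h x v *v w = jacobian_derivative h x w *v v"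
proof -
  have *: "jacobian_derivative h x v *v w = frechet_derivative (\<lambda>z. frechet_derivative h (at z) w) (at x) v" for v w
  proof -
    have "((\<lambda>z. jacobian h (at z) *v w) has_derivative (\<lambda>v. jacobian_derivative h x v *v w)) (at x)"
      by (rule bounded_linear.has_derivative[OF bounded_bilinear.bounded_linear_left[OF bounded_bilinear_matrix_vector_mult]
          smooth_on_has_derivative[OF smooth_on_jacobian[OF assms(1,2)] assms(3)]])
    then have "((\<lambda>z. frechet_derivative h (at z) w) has_derivative (\<lambda>v. jacobian_derivative h x v *v w)) (at x)"
      by (rule has_derivative_transform_within_open[OF _ assms(1,3)]) (simp add: jacobian_mult[OF assms(2)])
    from fun_cong[OF frechet_derivative_at[OF this], of v] show ?thesis .
  qed
  show ?thesis unfolding *[of v w] *[of w v] by (rule second_derivative_symmetric[OF assms(2,1,3)])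
qed

lemma lie_bracket_open:
  fixes h1 h2 :: "real^'n \<Rightarrow> real^'n"
  assumes "open V" "smooth_on V h1" "smooth_on V h2" "x \<in> V"
  shows "lie_bracket V h1 h2 x = jacobian h2 (at x) *v h1 x - jacobian h1 (at x) *v h2 x"
  by (simp add: lie_bracket_def at_within_open[OF assms(4,1)] jacobian_mult[OF assms(2,4)] jacobian_mult[OF assms(3,4)])

lemma smooth_on_lie_bracket:
  fixes h1 h2 :: "real^'n \<Rightarrow> real^'n"
  assumes "open V" "smooth_on V h1" "smooth_on V h2"
  shows "smooth_on V (lie_bracket V h1 h2)"
  by (rule smooth_on_cong[OF assms(1)
        smooth_on_diff[OF assms(1) smooth_on_derivative_apply[OF assms(1,3,2)] smooth_on_derivative_apply[OF assms]]])
     (simp add: lie_bracket_def at_within_open[OF _ assms(1)])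

text \<open>The product rule yields terms in which the second derivatives are applied to the direction of
  differentiation first; symmetry moves \<open>h1 x\<close> and \<open>h2 x\<close> into that slot, so that the direction
  factors out on the right.\<close>

lemma jacobian_lie_bracket:
  fixes h1 h2 :: "real^'n \<Rightarrow> real^'n"
  assumes "open V" "smooth_on V h1" "smooth_on V h2" "x \<in> V"
  shows "jacobian (lie_bracket V h1 h2) (at x) =
    jacobian_derivative h2 x (h1 x) + jacobian h2 (at x) ** jacobian h1 (at x)
    - (jacobian_derivative h1 x (h2 x) + jacobian h1 (at x) ** jacobian h2 (at x))"
proof (rule jacobian_eqI)
  have D: "((\<lambda>z. jacobian h (at z) *v k z) has_derivative
      (\<lambda>v. jacobian h (at x) *v (jacobian k (at x) *v v) + jacobian_derivative h x v *v k x)) (at x)"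
    if "smooth_on V h" "smooth_on V k" for h k :: "real^'n \<Rightarrow> real^'n"
    unfolding jacobian_mult[OF that(2) assms(4)]
    by (rule bounded_bilinear.FDERIV[OF bounded_bilinear_matrix_vector_mult
        smooth_on_has_derivative[OF smooth_on_jacobian[OF assms(1) that(1)] assms(4)]
        smooth_on_has_derivative[OF that(2) assms(4)]])
  have "((\<lambda>z. jacobian h2 (at z) *v h1 z - jacobian h1 (at z) *v h2 z) has_derivative
      (*v) (jacobian_derivative h2 x (h1 x) + jacobian h2 (at x) ** jacobian h1 (at x)
    - (jacobian_derivative h1 x (h2 x) + jacobian h1 (at x) ** jacobian h2 (at x)))) (at x)"
  proof (rule has_derivative_eq_rhs[OF has_derivative_diff[OF D[OF assms(3,2)] D[OF assms(2,3)]]], rule ext)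
    fix v
    show "jacobian h2 (at x) *v (jacobian h1 (at x) *v v) + jacobian_derivative h2 x v *v h1 x
      - (jacobian h1 (at x) *v (jacobian h2 (at x) *v v) + jacobian_derivative h1 x v *v h2 x)
      = (jacobian_derivative h2 x (h1 x) + jacobian h2 (at x) ** jacobian h1 (at x)
        - (jacobian_derivative h1 x (h2 x) + jacobian h1 (at x) ** jacobian h2 (at x))) *v v"
      unfolding jacobian_derivative_symmetric[OF assms(1,3,4), of v "h1 x"]
        jacobian_derivative_symmetric[OF assms(1,2,4), of v "h2 x"]
        matrix_vector_mult_diff_rdistrib matrix_vector_mult_add_rdistrib matrix_vector_mul_assoc
      by (simp only: add.commute)
  qed
  then show "(lie_bracket V h1 h2 has_derivative (*v) (jacobian_derivative h2 x (h1 x) + jacobian h2 (at x) ** jacobian h1 (at x)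
    - (jacobian_derivative h1 x (h2 x) + jacobian h1 (at x) ** jacobian h2 (at x)))) (at x)"
    by (rule has_derivative_transform_within_open[OF _ assms(1,4)]) (simp add: lie_bracket_open assms)
qed

section \<open>Fields that are affine in the covariance\<close>

text \<open>The shape common to all brackets of the fields \<^const>\<open>mean_cov_field\<close>: over a field \<open>h\<close> on the
  mean, the covariance moves by the linearization of \<open>h\<close> acting on symmetric matrices, plus a source
  term \<open>R\<close> that depends on the mean alone.\<close>

definition lifted_field ::
  "(real^'n \<Rightarrow> real^'n) \<Rightarrow> (real^'n \<Rightarrow> real^'n^'n) \<Rightarrow> (real^'n) \<times> (real^'n^'n) \<Rightarrow> (real^'n) \<times> (real^'n^'n)" where
  "lifted_field h R = (\<lambda>(m, P).
     (h m, jacobian h (at m) ** P + P ** transpose (jacobian h (at m)) + R m))"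

lemma lifted_field_has_derivative:
  fixes h :: "real^'n \<Rightarrow> real^'n" and R :: "real^'n \<Rightarrow> real^'n^'n"
  assumes "open V" "smooth_on V h" "smooth_on V R" "m \<in> V"
  shows "(lifted_field h R has_derivative (\<lambda>(v, Y). (jacobian h (at m) *v v,
      jacobian h (at m) ** Y + jacobian_derivative h m v ** P
      + (P ** transpose (jacobian_derivative h m v) + Y ** transpose (jacobian h (at m)))
      + frechet_derivative R (at m) v))) (at (m, P))"
proof -
  have fst: "((\<lambda>X. k (fst X)) has_derivative (\<lambda>Z. frechet_derivative k (at m) (fst Z))) (at (m, P))"
    if "smooth_on V k" for k :: "real^'n \<Rightarrow> 'b::real_normed_vector"
    using has_derivative_compose[OF has_derivative_fst[OF has_derivative_ident], of k "frechet_derivative k (at m)" "(m, P)"]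
      smooth_on_has_derivative[OF that assms(4)] by simp
  have snd: "(snd has_derivative snd) (at (m, P))"
    by (auto intro!: derivative_eq_intros)
  note J = fst[OF smooth_on_jacobian[OF assms(1,2)]]
  note mm = bounded_bilinear.FDERIV[OF bounded_bilinear_matrix_mult]
  have "((\<lambda>X. (h (fst X), jacobian h (at (fst X)) ** snd X + snd X ** transpose (jacobian h (at (fst X))) + R (fst X)))
     has_derivative (\<lambda>Z. (frechet_derivative h (at m) (fst Z),
      (jacobian h (at (fst (m, P))) ** snd Z + jacobian_derivative h m (fst Z) ** snd (m, P))
      + (snd (m, P) ** transpose (jacobian_derivative h m (fst Z)) + snd Z ** transpose (jacobian h (at (fst (m, P)))))
      + frechet_derivative R (at m) (fst Z)))) (at (m, P))"
    by (rule has_derivative_Pair[OF fst[OF assms(2)] has_derivative_add[OF has_derivative_add[OF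
        mm[OF J snd] mm[OF snd bounded_linear.has_derivative[OF bounded_linear_transpose J]]]
        fst[OF assms(3)]]])
  then show ?thesis
    by (simp add: lifted_field_def case_prod_beta' jacobian_mult[OF assms(2,4)])
qed

lemma symmetric_frechet_derivative:
  fixes R :: "real^'n \<Rightarrow> real^'k^'k"
  assumes "open V" "smooth_on V R" "x \<in> V" "\<And>x. x \<in> V \<Longrightarrow> transpose (R x) = R x"
  shows "transpose (frechet_derivative R (at x) v) = frechet_derivative R (at x) v"
proof -
  have "((\<lambda>z. transpose (R z)) has_derivative (\<lambda>v. transpose (frechet_derivative R (at x) v))) (at x)"
    by (intro bounded_linear.has_derivative[OF bounded_linear_transpose] smooth_on_has_derivative[OF assms(2,3)])
  then have "(R has_derivative (\<lambda>v. transpose (frechet_derivative R (at x) v))) (at x)"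
    by (rule has_derivative_transform_within_open[OF _ assms(1,3)]) (simp add: assms(4))
  from fun_cong[OF frechet_derivative_at[OF this], of v] show ?thesis .
qed

section \<open>Derivatives on the state space\<close>

text \<open>A set that contains a short segment from \<open>x\<close> in direction \<open>v\<close> determines every derivative
  within it in direction \<open>v\<close>: restrict to the segment.\<close>

lemma has_derivative_within_unique_ray:
  fixes f :: "'a::real_normed_vector \<Rightarrow> 'b::real_normed_vector"
  assumes "(f has_derivative D1) (at x within S)" "(f has_derivative D2) (at x within S)"
    and "\<delta> > 0" "\<And>t. 0 < t \<Longrightarrow> t < \<delta> \<Longrightarrow> x + t *\<^sub>R v \<in> S"
  shows "D1 v = D2 v"
proof -
  let ?T = "{0<..<\<delta>}"
  have vd: "((\<lambda>t. f (x + t *\<^sub>R v)) has_vector_derivative D v) (at 0 within ?T)"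
    if "(f has_derivative D) (at x within S)" for D
  proof -
    have "((\<lambda>t. x + t *\<^sub>R v) has_derivative (\<lambda>t. t *\<^sub>R v)) (at 0 within ?T)"
      by (auto intro!: derivative_eq_intros)
    moreover have "(f has_derivative D) (at (x + 0 *\<^sub>R v) within (\<lambda>t. x + t *\<^sub>R v) ` ?T)"
      using that by (auto intro!: has_derivative_subset[OF that] assms(4))
    ultimately have "((\<lambda>t. f (x + t *\<^sub>R v)) has_derivative (\<lambda>t. D (t *\<^sub>R v))) (at 0 within ?T)"
      by (rule has_derivative_in_compose)
    then show ?thesis
      using linear_scale[OF has_derivative_linear[OF that]] by (simp add: has_vector_derivative_def)
  qed
  have "at 0 within ?T \<noteq> bot"
  proof -
    have "?T - {0} = ?T" by auto
    then show ?thesis using assms(3) by (simp add: at_within_eq_bot_iff)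
  qed
  then show ?thesis
    using vector_derivative_unique_within[OF _ vd[OF assms(1)] vd[OF assms(2)]] by simp
qed

lemma sym_posdef_transpose: "P \<in> sym_posdef \<Longrightarrow> transpose P = P"
  by (simp add: sym_posdef_def)

lemma sym_posdef_scaleR: "c > 0 \<Longrightarrow> P \<in> sym_posdef \<Longrightarrow> c *\<^sub>R P \<in> sym_posdef"
  by (simp add: sym_posdef_def transpose_lin scaleR_matrix_vector_assoc[symmetric])

lemma sym_posdef_add: "P \<in> sym_posdef \<Longrightarrow> Q \<in> sym_posdef \<Longrightarrow> P + Q \<in> sym_posdef"
  by (simp add: sym_posdef_def transpose_lin matrix_vector_mult_add_rdistrib inner_add_right add_pos_pos)

lemma sym_posdef_identity: "mat 1 \<in> sym_posdef"
  by (simp add: sym_posdef_def)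

lemma sym_posdef_segment:
  assumes "P \<in> sym_posdef" "Q \<in> sym_posdef" "0 < t" "t < 1"
  shows "P + t *\<^sub>R (Q - P) \<in> sym_posdef"
proof -
  have "P + t *\<^sub>R (Q - P) = (1 - t) *\<^sub>R P + t *\<^sub>R Q" by (simp add: algebra_simps)
  then show ?thesis using assms by (simp add: sym_posdef_add sym_posdef_scaleR)
qed

text \<open>Every symmetric matrix is a difference of positive definite ones. Adding positive definite
  matrices never leaves the cone, so derivatives within the state space are determined in positive
  definite directions, and by linearity then in all symmetric directions.\<close>

lemma symmetric_plus_identity_posdef:
  fixes Y :: "real^'n^'n"
  assumes "transpose Y = Y"
  obtains c where "c > 0" "Y + c *\<^sub>R mat 1 \<in> sym_posdef"
proof -
  obtain K where K: "K > 0" "\<And>x. norm (Y *v x) \<le> norm x * K"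
    using bounded_linear.pos_bounded[OF matrix_vector_mul_bounded_linear[of Y]] by blast
  have "x \<bullet> ((Y + (K + 1) *\<^sub>R mat 1) *v x) > 0" if "x \<noteq> 0" for x
  proof -
    have "\<bar>x \<bullet> (Y *v x)\<bar> \<le> norm x * (norm x * K)"
      using Cauchy_Schwarz_ineq2[of x "Y *v x"] K(2)[of x]
      by (meson mult_left_mono norm_ge_zero order_trans)
    moreover have "x \<bullet> ((Y + (K + 1) *\<^sub>R mat 1) *v x) = x \<bullet> (Y *v x) + (K + 1) * (norm x * norm x)"
      by (simp add: matrix_vector_mult_add_rdistrib scaleR_matrix_vector_assoc[symmetric]
          inner_add_right dot_square_norm power2_eq_square)
    moreover have "norm x * norm x > 0" using that by simp
    ultimately show ?thesis by (simp add: algebra_simps)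
  qed
  then have "Y + (K + 1) *\<^sub>R mat 1 \<in> sym_posdef"
    using assms by (auto simp: sym_posdef_def transpose_lin)
  then show ?thesis using K(1) that[of "K + 1"] by auto
qed

text \<open>The derivative within \<open>V \<times> sym_posdef\<close> need not be unique as a linear map on the ambient
  space, because in dimension two and above the symmetric matrices form a proper subspace; on vectors tangent to the state space it
  nevertheless agrees with the derivative of any extension \<open>G\<close> of the field.\<close>

lemma frechet_derivative_within_state_space:
  fixes G :: "(real^'n) \<times> (real^'n^'n) \<Rightarrow> 'b::real_normed_vector"
  assumes "open V" "m \<in> V" "P \<in> sym_posdef" "transpose Y = Y"
    and D: "(G has_derivative D) (at (m, P))"
    and eq: "\<forall>X\<in>V \<times> sym_posdef. H X = G X"
  shows "frechet_derivative H (at (m, P) within V \<times> sym_posdef) (v, Y) = D (v, Y)"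
proof -
  let ?M = "V \<times> (sym_posdef :: (real^'n^'n) set)"
  let ?D = "frechet_derivative H (at (m, P) within ?M)"
  have HD: "(H has_derivative D) (at (m, P) within ?M)"
    using has_derivative_transform[OF _ bspec[OF eq] has_derivative_at_withinI[OF D]] assms by auto
  then have HD': "(H has_derivative ?D) (at (m, P) within ?M)"
    using differentiableI frechet_derivative_works by blast
  have ray: "?D (v, Q) = D (v, Q)" if Q: "Q \<in> sym_posdef" for v Q
  proof -
    obtain e where e: "e > 0" "ball m e \<subseteq> V" using assms(1,2) openE by blast
    show ?thesis
    proof (rule has_derivative_within_unique_ray[OF HD' HD])
      show "e / (norm v + 1) > 0" using e by (simp add: add_nonneg_pos)
      fix t :: real assume t: "0 < t" "t < e / (norm v + 1)"
      have "t * norm v \<le> t * (norm v + 1)" using t by simp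
      also have "\<dots> < e" using t by (simp add: pos_less_divide_eq add_nonneg_pos)
      finally have "m + t *\<^sub>R v \<in> V" using e t by (auto simp: dist_norm subset_iff)
      moreover have "P + t *\<^sub>R Q \<in> sym_posdef"
        using t Q assms(3) by (simp add: sym_posdef_add sym_posdef_scaleR)
      ultimately show "(m, P) + t *\<^sub>R (v, Q) \<in> ?M" by simp
    qed
  qed
  obtain c where c: "c > 0" "Y + c *\<^sub>R mat 1 \<in> sym_posdef"
    using symmetric_plus_identity_posdef[OF assms(4)] .
  have split: "(v, Y) = (v, Y + c *\<^sub>R mat 1) - (0, c *\<^sub>R mat 1)" by simp
  show ?thesis
    unfolding split linear_diff[OF has_derivative_linear[OF HD']] linear_diff[OF has_derivative_linear[OF HD]]
    using ray[OF c(2)] ray[OF sym_posdef_scaleR[OF c(1) sym_posdef_identity]] by simp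
qed

section \<open>Brackets of lifted fields\<close>

text \<open>The identity for \<open>H\<close> is required on the state space only, since a bracket taken within
  that set has no prescribed values elsewhere. Symmetry of \<open>R\<close> keeps the values of \<open>H\<close> tangent to
  the symmetric matrices, where its derivatives are determined.\<close>

definition lifts ::
  "(real^'n) set \<Rightarrow> (real^'n \<Rightarrow> real^'n) \<Rightarrow>
   ((real^'n) \<times> (real^'n^'n) \<Rightarrow> (real^'n) \<times> (real^'n^'n)) \<Rightarrow> bool" where
  "lifts V h H \<longleftrightarrow> smooth_on V h \<and>
     (\<exists>R. smooth_on V R \<and> (\<forall>m\<in>V. transpose (R m) = R m) \<and>
          (\<forall>X\<in>V \<times> sym_posdef. H X = lifted_field h R X))"

text \<open>With \<open>A\<^sub>i\<close> the Jacobian of \<open>h\<^sub>i\<close>, each half of the bracket contains the mixed terms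
  \<open>A\<^sub>2 P A\<^sub>1\<^sup>T + A\<^sub>1 P A\<^sub>2\<^sup>T\<close>; they are symmetric under exchange of the indices and cancel. What remains
  linear in \<open>P\<close> is \<open>D P + P D\<^sup>T\<close>, where \<open>D\<close> is the Jacobian of the bracket of \<open>h\<^sub>1\<close> and \<open>h\<^sub>2\<close>. Everything else depends on the mean only and forms the new source term.\<close>

lemma lifts_lie_bracket:
  assumes V: "open V" and "lifts V h1 H1" "lifts V h2 H2"
  shows "lifts V (lie_bracket V h1 h2) (lie_bracket (V \<times> sym_posdef) H1 H2)"
proof -
  obtain R1 where h1: "smooth_on V h1" and R1: "smooth_on V R1" "\<And>m. m \<in> V \<Longrightarrow> transpose (R1 m) = R1 m"
    and H1: "\<forall>X\<in>V \<times> sym_posdef. H1 X = lifted_field h1 R1 X"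
    using assms(2) unfolding lifts_def by blast
  obtain R2 where h2: "smooth_on V h2" and R2: "smooth_on V R2" "\<And>m. m \<in> V \<Longrightarrow> transpose (R2 m) = R2 m"
    and H2: "\<forall>X\<in>V \<times> sym_posdef. H2 X = lifted_field h2 R2 X"
    using assms(3) unfolding lifts_def by blast
  let ?J1 = "\<lambda>m. jacobian h1 (at m)" and ?J2 = "\<lambda>m. jacobian h2 (at m)"
  \<comment> \<open>Half of the new source term: \<open>R\<close> differentiated along \<open>k\<close>, and \<open>Q\<close> moved by the linearization of \<open>h\<close>.\<close>
  define T where "T h k Q R m = frechet_derivative R (at m) (k m)
      + (jacobian h (at m) ** Q m + Q m ** transpose (jacobian h (at m)))"
    for h k and Q R :: "real^'a \<Rightarrow> real^'a^'a" and m
  define R where "R m = T h2 h1 R1 R2 m - T h1 h2 R2 R1 m" for m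
  have T: "smooth_on V (T h k Q R)" if "smooth_on V h" "smooth_on V k" "smooth_on V Q" "smooth_on V R" for h k Q R
    unfolding T_def
    by (rule smooth_on_add[OF V smooth_on_derivative_apply[OF V that(4,2)]
          smooth_on_add[OF V smooth_on_bilinear[OF V bounded_bilinear_matrix_mult smooth_on_jacobian[OF V that(1)] that(3)]
            smooth_on_bilinear[OF V bounded_bilinear_matrix_mult that(3)
              smooth_on_linear[OF V bounded_linear_transpose smooth_on_jacobian[OF V that(1)]]]]])
  have "smooth_on V R"
    unfolding R_def by (rule smooth_on_diff[OF V T[OF h2 h1 R1(1) R2(1)] T[OF h1 h2 R2(1) R1(1)]])
  moreover have "transpose (R m) = R m" if m: "m \<in> V" for m
    unfolding R_def T_def
    by (simp add: transpose_lin matrix_transpose_mul R1(2)[OF m] R2(2)[OF m]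
        symmetric_frechet_derivative[OF V R1(1) m R1(2)] symmetric_frechet_derivative[OF V R2(1) m R2(2)] add.commute)
  moreover have "lie_bracket (V \<times> sym_posdef) H1 H2 X = lifted_field (lie_bracket V h1 h2) R X"
    if "X \<in> V \<times> sym_posdef" for X
  proof -
    obtain m P where X: "X = (m, P)" and m: "m \<in> V" and P: "P \<in> sym_posdef" using \<open>X \<in> V \<times> sym_posdef\<close> by auto
    note Psym = sym_posdef_transpose[OF P]
    have Y: "transpose (jacobian h (at m) ** P + P ** transpose (jacobian h (at m)) + Q) =
        jacobian h (at m) ** P + P ** transpose (jacobian h (at m)) + Q"
      if "transpose Q = Q" for h :: "real^'a \<Rightarrow> real^'a" and Q
      using that by (simp add: transpose_lin matrix_transpose_mul Psym add.commute)
    have F1: "H1 X = (h1 m, ?J1 m ** P + P ** transpose (?J1 m) + R1 m)"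
      and F2: "H2 X = (h2 m, ?J2 m ** P + P ** transpose (?J2 m) + R2 m)"
      using bspec[OF H1 that] bspec[OF H2 that] by (simp_all add: X lifted_field_def)
    note D1 = frechet_derivative_within_state_space[OF V m P Y[OF R2(2)[OF m]]
        lifted_field_has_derivative[OF V h1 R1(1) m] H1]
    note D2 = frechet_derivative_within_state_space[OF V m P Y[OF R1(2)[OF m]]
        lifted_field_has_derivative[OF V h2 R2(1) m] H2]
    show ?thesis
      unfolding lie_bracket_def[of "V \<times> sym_posdef"] F1 F2 unfolding X D1 D2
      by (simp add: lifted_field_def lie_bracket_open[OF V h1 h2 m] jacobian_lie_bracket[OF V h1 h2 m] R_def T_def
          matrix_mult_lin transpose_lin matrix_transpose_mul matrix_mul_assoc algebra_simps)
  qed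
  ultimately show ?thesis
    unfolding lifts_def using smooth_on_lie_bracket[OF V h1 h2] by blast
qed

lemma lifts_nested_bracket:
  assumes "open V" "\<And>u. u \<in> set us \<Longrightarrow> lifts V (\<phi> u) (\<Phi> u)" "us \<noteq> []"
  shows "lifts V (nested_bracket V (map \<phi> us)) (nested_bracket (V \<times> sym_posdef) (map \<Phi> us))"
  using assms(2,3)
proof (induction us)
  case (Cons u us)
  show ?case
  proof (cases us)
    case Nil
    then show ?thesis using Cons by simp
  next
    case (Cons w ws)
    then show ?thesis using Cons.IH Cons.prems lifts_lie_bracket[OF assms(1)] by simp
  qed
qed simp

lemma lifts_zero:
  fixes V :: "(real^'n) set"
  shows "lifts V 0 0"
proof -
  have "jacobian (\<lambda>_. 0 :: real^'n) (at m) = 0" for m :: "real^'n"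
    by (rule jacobian_eqI) simp
  moreover have "transpose (0 :: real^'n^'n) = 0"
    by (rule linear_0[OF bounded_linear.linear[OF bounded_linear_transpose]])
  ultimately show ?thesis
    unfolding lifts_def
    by (auto simp: zero_fun_def lifted_field_def smooth_on_const zero_prod_def
        bounded_bilinear.zero_left[OF bounded_bilinear_matrix_mult]
        bounded_bilinear.zero_right[OF bounded_bilinear_matrix_mult] intro!: exI[of _ "\<lambda>_. 0"])
qed

lemma lifts_linear_combination:
  assumes V: "open V" and "lifts V h1 H1" "lifts V h2 H2"
  shows "lifts V (a *\<^sub>R h1 + b *\<^sub>R h2) (a *\<^sub>R H1 + b *\<^sub>R H2)"
proof -
  have eq: "a *\<^sub>R f + b *\<^sub>R k = (\<lambda>x. a *\<^sub>R f x + b *\<^sub>R k x)" for f k :: "'x \<Rightarrow> 'y::real_vector"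
    by (simp add: scaleR_fun_def plus_fun_def)
  obtain R1 where h1: "smooth_on V h1" and R1: "smooth_on V R1" "\<And>m. m \<in> V \<Longrightarrow> transpose (R1 m) = R1 m"
    and H1: "\<And>X. X \<in> V \<times> sym_posdef \<Longrightarrow> H1 X = lifted_field h1 R1 X"
    using assms(2) unfolding lifts_def by blast
  obtain R2 where h2: "smooth_on V h2" and R2: "smooth_on V R2" "\<And>m. m \<in> V \<Longrightarrow> transpose (R2 m) = R2 m"
    and H2: "\<And>X. X \<in> V \<times> sym_posdef \<Longrightarrow> H2 X = lifted_field h2 R2 X"
    using assms(3) unfolding lifts_def by blast
  have s: "smooth_on V (\<lambda>x. a *\<^sub>R f x + b *\<^sub>R k x)" if "smooth_on V f" "smooth_on V k"
    for f k :: "real^'a \<Rightarrow> 'y::real_normed_vector"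
    by (rule smooth_on_add[OF V smooth_on_linear[OF V bounded_linear_scaleR_right that(1)]
          smooth_on_linear[OF V bounded_linear_scaleR_right that(2)]])
  have J: "jacobian (\<lambda>x. a *\<^sub>R h1 x + b *\<^sub>R h2 x) (at m) = a *\<^sub>R jacobian h1 (at m) + b *\<^sub>R jacobian h2 (at m)"
    if "m \<in> V" for m
  proof (rule jacobian_eqI)
    have D: "(h has_derivative (*v) (jacobian h (at m))) (at m)" if "smooth_on V h" for h :: "real^'a \<Rightarrow> real^'a"
      using smooth_on_has_derivative[OF that \<open>m \<in> V\<close>] differentiableI jacobian_works by blast
    show "((\<lambda>x. a *\<^sub>R h1 x + b *\<^sub>R h2 x) has_derivative
        (*v) (a *\<^sub>R jacobian h1 (at m) + b *\<^sub>R jacobian h2 (at m))) (at m)"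
      by (rule has_derivative_eq_rhs[OF has_derivative_add[OF has_derivative_scaleR_right[OF D[OF h1]]
              has_derivative_scaleR_right[OF D[OF h2]]]])
         (simp add: fun_eq_iff matrix_vector_mult_add_rdistrib scaleR_matrix_vector_assoc)
  qed
  have "(a *\<^sub>R H1 + b *\<^sub>R H2) X = lifted_field (a *\<^sub>R h1 + b *\<^sub>R h2) (\<lambda>m. a *\<^sub>R R1 m + b *\<^sub>R R2 m) X"
    if "X \<in> V \<times> sym_posdef" for X
    using that by (auto simp: eq H1 H2 lifted_field_def J matrix_mult_lin transpose_lin algebra_simps)
  moreover have "smooth_on V (\<lambda>m. a *\<^sub>R R1 m + b *\<^sub>R R2 m)" by (rule s[OF R1(1) R2(1)])
  moreover have "\<forall>m\<in>V. transpose (a *\<^sub>R R1 m + b *\<^sub>R R2 m) = a *\<^sub>R R1 m + b *\<^sub>R R2 m"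
    by (simp add: transpose_lin R1 R2)
  moreover have "smooth_on V (a *\<^sub>R h1 + b *\<^sub>R h2)" unfolding eq by (rule s[OF h1 h2])
  ultimately show ?thesis unfolding lifts_def by blast
qed

text \<open>The two span lemmas have different targets: this one lifts each \<open>h\<close> in the span, and so
  provides enough fields for the rank to be large; the converse one describes every field upstairs,
  which bounds the rank from above and gives continuity.\<close>

lemma lifts_span:
  assumes V: "open V" and B: "\<And>h. h \<in> B \<Longrightarrow> \<exists>H\<in>B'. lifts V h H" and "h \<in> span B"
  shows "\<exists>H\<in>span B'. lifts V h H"
proof -
  have "subspace {h. \<exists>H\<in>span B'. lifts V h H}"
    unfolding subspace_def
  proof (intro conjI ballI allI)
    show "0 \<in> {h. \<exists>H\<in>span B'. lifts V h H}" using lifts_zero span_zero by blast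
  next
    fix x y assume "x \<in> {h. \<exists>H\<in>span B'. lifts V h H}" "y \<in> {h. \<exists>H\<in>span B'. lifts V h H}"
    then obtain H K where "H \<in> span B'" "K \<in> span B'" "lifts V x H" "lifts V y K" by blast
    then show "x + y \<in> {h. \<exists>H\<in>span B'. lifts V h H}"
      using lifts_linear_combination[OF V, of x H y K 1 1] span_add by force
  next
    fix c :: real and x assume "x \<in> {h. \<exists>H\<in>span B'. lifts V h H}"
    then obtain H where "H \<in> span B'" "lifts V x H" by blast
    then show "c *\<^sub>R x \<in> {h. \<exists>H\<in>span B'. lifts V h H}"
      using lifts_linear_combination[OF V, of x H x H c 0] span_scale by force
  qed
  then have "span B \<subseteq> {h. \<exists>H\<in>span B'. lifts V h H}"
    using B span_base by (intro span_minimal) blast+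
  then show ?thesis using assms(3) by blast
qed

lemma lifts_span_converse:
  assumes V: "open V" and B: "\<And>H. H \<in> B' \<Longrightarrow> \<exists>h. lifts V h H" and "H \<in> span B'"
  shows "\<exists>h. lifts V h H"
proof -
  have "subspace {H. \<exists>h. lifts V h H}"
    unfolding subspace_def
  proof (intro conjI ballI allI)
    show "0 \<in> {H. \<exists>h. lifts V h H}" using lifts_zero by blast
  next
    fix x y assume "x \<in> {H. \<exists>h. lifts V h H}" "y \<in> {H. \<exists>h. lifts V h H}"
    then obtain h k where "lifts V h x" "lifts V k y" by blast
    then show "x + y \<in> {H. \<exists>h. lifts V h H}"
      using lifts_linear_combination[OF V, of h x k y 1 1] by force
  next
    fix c :: real and x assume "x \<in> {H. \<exists>h. lifts V h H}"
    then obtain h where "lifts V h x" by blast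
    then show "c *\<^sub>R x \<in> {H. \<exists>h. lifts V h H}"
      using lifts_linear_combination[OF V, of h x h x c 0] by force
  qed
  then have "span B' \<subseteq> {H. \<exists>h. lifts V h H}"
    using B by (intro span_minimal) blast+
  then show ?thesis using assms(3) by blast
qed

section \<open>Pencils, perturbations and the dimension of the state space\<close>

text \<open>Applying \<open>T - \<nu>\<close> to a linear relation removes the eigenvector for \<open>\<nu>\<close> and multiplies the
  remaining coefficients by nonzero factors, so the induction is on the number of eigenvalues.\<close>

lemma eigenvectors_independent:
  fixes T :: "'a::real_vector \<Rightarrow> 'a"
  assumes T: "linear T" and e: "\<And>\<mu>. \<mu> \<in> F \<Longrightarrow> e \<mu> \<noteq> 0" "\<And>\<mu>. \<mu> \<in> F \<Longrightarrow> T (e \<mu>) = \<mu> *\<^sub>R e \<mu>"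
    and "finite F" "(\<Sum>\<mu>\<in>F. c \<mu> *\<^sub>R e \<mu>) = 0" "\<mu> \<in> F"
  shows "c \<mu> = (0::real)"
  using assms(4,2,3,5,6)
proof (induction F arbitrary: c \<mu> rule: finite_induct)
  case (insert \<nu> F)
  have "(\<Sum>\<mu>\<in>F. (c \<mu> * (\<mu> - \<nu>)) *\<^sub>R e \<mu>) = T (\<Sum>\<mu>\<in>insert \<nu> F. c \<mu> *\<^sub>R e \<mu>) - \<nu> *\<^sub>R (\<Sum>\<mu>\<in>insert \<nu> F. c \<mu> *\<^sub>R e \<mu>)"
    using insert.hyps insert.prems(2)
    by (simp add: linear_sum[OF T] linear_add[OF T] linear_scale[OF T] scaleR_sum_right sum_subtractf algebra_simps)
  also have "\<dots> = 0" using insert.prems(3) linear_0[OF T] by simp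
  finally have "\<And>\<mu>. \<mu> \<in> F \<Longrightarrow> c \<mu> * (\<mu> - \<nu>) = 0"
    using insert.IH[of "\<lambda>\<mu>. c \<mu> * (\<mu> - \<nu>)"] insert.prems by blast
  then have F: "c \<mu> = 0" if "\<mu> \<in> F" for \<mu> using that insert.hyps(2) by fastforce
  then have "c \<nu> *\<^sub>R e \<nu> = 0" using insert.prems(3) insert.hyps by simp
  then show ?case using F insert.prems(1,4) by auto
qed simp

lemma finite_eigenvalues:
  fixes T :: "'a::euclidean_space \<Rightarrow> 'a"
  assumes T: "linear T"
  shows "finite {\<mu>. \<exists>x. x \<noteq> 0 \<and> T x = \<mu> *\<^sub>R x}" (is "finite ?E")
proof (rule ccontr)
  assume "infinite ?E"
  then obtain F where F: "finite F" "card F = Suc DIM('a)" "F \<subseteq> ?E"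
    using infinite_arbitrarily_large by blast
  then have "\<forall>\<mu>\<in>F. \<exists>x. x \<noteq> 0 \<and> T x = \<mu> *\<^sub>R x" by blast
  then obtain e where e: "\<And>\<mu>. \<mu> \<in> F \<Longrightarrow> e \<mu> \<noteq> 0" "\<And>\<mu>. \<mu> \<in> F \<Longrightarrow> T (e \<mu>) = \<mu> *\<^sub>R e \<mu>"
    by metis
  have inj: "inj_on e F"
  proof (rule inj_onI)
    fix \<mu> \<nu> assume "\<mu> \<in> F" "\<nu> \<in> F" "e \<mu> = e \<nu>"
    then have "\<mu> *\<^sub>R e \<mu> = \<nu> *\<^sub>R e \<mu>" using e(2)[of \<mu>] e(2)[of \<nu>] by metis
    then show "\<mu> = \<nu>" using e(1)[OF \<open>\<mu> \<in> F\<close>] by (metis scaleR_right_imp_eq)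
  qed
  have "independent (e ` F)"
    unfolding independent_explicit
  proof (intro conjI allI impI ballI)
    show "finite (e ` F)" using F by simp
    fix c v assume "(\<Sum>v\<in>e ` F. c v *\<^sub>R v) = 0" "v \<in> e ` F"
    then show "c v = 0"
      using eigenvectors_independent[OF T e F(1), of "\<lambda>\<mu>. c (e \<mu>)"] by (auto simp: sum.reindex[OF inj])
  qed
  then have "card (e ` F) \<le> DIM('a)" using independent_bound by blast
  then show False using card_image[OF inj] F(2) by simp
qed

text \<open>Singular parameters of the pencil \<open>C + s D\<close> are \<open>- 1 / \<mu>\<close> for eigenvalues \<open>\<mu>\<close> of
  \<open>C' \<circ> D\<close>, with \<open>C'\<close> a left inverse of \<open>C\<close>. This takes the place
  of the remark that a determinant is a polynomial in \<open>s\<close> and avoids choosing coordinates on the tangent space.\<close>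

lemma finite_singular_pencil:
  fixes C D :: "'a::euclidean_space \<Rightarrow> 'a"
  assumes C: "linear C" "inj C" and D: "linear D"
  shows "finite {s. \<not> inj (\<lambda>x. C x + s *\<^sub>R D x)}"
proof -
  obtain C' where C': "linear C'" "C' \<circ> C = id" using linear_injective_left_inverse[OF C] by blast
  let ?E = "{\<mu>. \<exists>x. x \<noteq> 0 \<and> (C' \<circ> D) x = \<mu> *\<^sub>R x}"
  have "{s. \<not> inj (\<lambda>x. C x + s *\<^sub>R D x)} \<subseteq> (\<lambda>\<mu>. - 1 / \<mu>) ` ?E"
  proof
    fix s assume "s \<in> {s. \<not> inj (\<lambda>x. C x + s *\<^sub>R D x)}"
    moreover have "linear (\<lambda>x. C x + s *\<^sub>R D x)"
      using C(1) D by (intro linear_compose_add linear_compose_scale_right)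
    ultimately obtain x where x: "x \<noteq> 0" "C x + s *\<^sub>R D x = 0"
      using linear_injective_0 by blast
    then have "C' (C x + s *\<^sub>R D x) = 0" using linear_0[OF C'(1)] by simp
    then have 0: "x + s *\<^sub>R C' (D x) = 0"
      using fun_cong[OF C'(2), of x] by (simp add: linear_add[OF C'(1)] linear_scale[OF C'(1)])
    then have s: "s \<noteq> 0" using x by auto
    have "s *\<^sub>R C' (D x) = - x" using 0 by (simp add: eq_neg_iff_add_eq_0 add.commute)
    then have "inverse s *\<^sub>R (s *\<^sub>R C' (D x)) = inverse s *\<^sub>R (- x)" by simp
    then have "C' (D x) = (- 1 / s) *\<^sub>R x" using s by (simp add: divide_inverse)
    then have "- 1 / s \<in> ?E" using x by auto
    then show "s \<in> (\<lambda>\<mu>. - 1 / \<mu>) ` ?E" by (rule rev_image_eqI) (use s in simp)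
  qed
  then show ?thesis
    using finite_eigenvalues[OF linear_compose[OF D C'(1)]] finite_subset by blast
qed

text \<open>Independence is an open condition, in quantitative form. An injective linear \<open>L\<close>
  with \<open>L b = w b\<close> on \<open>B\<close> certifies both that the vectors \<open>w b\<close> are distinct and that they are independent.\<close>

lemma independent_perturbation:
  fixes B :: "'a::euclidean_space set"
  assumes B: "independent B"
  obtains K where "K \<ge> 0"
    "\<And>w. K * (\<Sum>b\<in>B. norm (w b - b)) < 1 \<Longrightarrow> \<exists>L. linear L \<and> inj L \<and> (\<forall>b\<in>B. L b = w b)"
proof -
  have fB: "finite B" using independent_bound[OF B] by blast
  have "\<exists>q :: 'a \<Rightarrow> real. linear q \<and> (\<forall>x\<in>B. q x = (if x = b then 1 else 0))" for b
    by (rule linear_independent_extend[OF B])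
  then obtain q :: "'a \<Rightarrow> 'a \<Rightarrow> real" where q: "\<And>b. linear (q b)"
    "\<And>b x. x \<in> B \<Longrightarrow> q b x = (if x = b then 1 else 0)"
    by metis
  have "\<exists>k>0. \<forall>x. \<bar>q b x\<bar> \<le> norm x * k" for b
    using bounded_linear.pos_bounded[of "q b"] q(1)[of b] by (simp add: linear_conv_bounded_linear)
  then obtain k where k: "\<And>b. k b > 0" "\<And>b x. \<bar>q b x\<bar> \<le> norm x * k b" by metis
  define K where "K = sum k B"
  have kK: "k b \<le> K" if "b \<in> B" for b
    unfolding K_def using that fB k(1) by (intro member_le_sum) (auto intro: less_imp_le)
  show ?thesis
  proof (rule that)
    show "K \<ge> 0" unfolding K_def using k(1) by (intro sum_nonneg) (simp add: less_imp_le)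
    fix w :: "'a \<Rightarrow> 'a" assume w: "K * (\<Sum>b\<in>B. norm (w b - b)) < 1"
    \<comment> \<open>The identity plus a map of norm below one, hence injective; \<open>q b\<close> is the coordinate of \<open>b\<close>.\<close>
    define L where "L x = x + (\<Sum>b\<in>B. q b x *\<^sub>R (w b - b))" for x
    have lin: "linear L"
      unfolding L_def
      by (rule linearI)
         (simp_all add: linear_add[OF q(1)] linear_scale[OF q(1)] scaleR_left_distrib sum.distrib
           scaleR_sum_right scaleR_add_right)
    have "x = 0" if "L x = 0" for x
    proof -
      have "norm x = norm (\<Sum>b\<in>B. q b x *\<^sub>R (w b - b))"
        using that unfolding L_def by (metis add_eq_0_iff norm_minus_cancel)
      also have "\<dots> \<le> (\<Sum>b\<in>B. norm x * (K * norm (w b - b)))"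
      proof (rule sum_norm_le)
        fix b assume "b \<in> B"
        then have "\<bar>q b x\<bar> \<le> norm x * K" using k(2)[of b x] kK[of b] by (meson mult_left_mono norm_ge_zero order_trans)
        then show "norm (q b x *\<^sub>R (w b - b)) \<le> norm x * (K * norm (w b - b))"
          using mult_right_mono[of "\<bar>q b x\<bar>" "norm x * K" "norm (w b - b)"] by (simp add: mult.assoc)
      qed
      also have "\<dots> = norm x * (K * (\<Sum>b\<in>B. norm (w b - b)))" by (simp add: sum_distrib_left)
      finally have *: "norm x \<le> norm x * (K * (\<Sum>b\<in>B. norm (w b - b)))" .
      show "x = 0"
      proof (rule ccontr)
        assume "x \<noteq> 0"
        then have "norm x * (K * (\<Sum>b\<in>B. norm (w b - b))) < norm x * 1"
          using w by (intro mult_strict_left_mono) auto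
        then show False using * by simp
      qed
    qed
    then have "inj L" using linear_injective_0[OF lin] by blast
    moreover have "L b = w b" if "b \<in> B" for b
    proof -
      have "(\<Sum>b'\<in>B. q b' b *\<^sub>R (w b' - b')) = (\<Sum>b'\<in>B. if b' = b then w b' - b' else 0)"
        by (intro sum.cong) (auto simp: q(2)[OF that])
      then show ?thesis using that fB by (simp add: L_def sum.delta)
    qed
    ultimately show "\<exists>L. linear L \<and> inj L \<and> (\<forall>b\<in>B. L b = w b)" using lin by blast
  qed
qed

lemma card_le_dim_of_injection:
  fixes B :: "'a::euclidean_space set" and L :: "'a \<Rightarrow> 'a"
  assumes "independent B" "linear L" "inj L" "\<And>b. b \<in> B \<Longrightarrow> L b \<in> S"
  shows "card B \<le> dim S"
proof -
  have "independent (L ` B)"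
    using linear_independent_injective_image[OF assms(2,1)] assms(3) by (simp add: inj_on_subset)
  then have "card (L ` B) \<le> dim S" using assms(4) by (intro independent_card_le_dim) auto
  then show ?thesis using card_image[of L B] assms(3) by (simp add: inj_on_subset)
qed

text \<open>The symmetric matrices are spanned by indicator matrices of one- and two-element index sets;
  indexing by sets \<open>{i, j}\<close> avoids an order on the index type.\<close>

lemma dim_symmetric_pairs:
  "dim {(x :: real^'n, Y :: real^'n^'n). transpose Y = Y} \<le> state_dim TYPE('n)"
proof -
  define S where "S = {s :: 'n set. card s = 1} \<union> {s. card s = 2}"
  define Ind where "Ind s = (\<chi> i j. if {i, j} = s then 1 else (0::real))" for s :: "'n set"
  define W :: "((real^'n) \<times> (real^'n^'n)) set" where "W = (\<lambda>i. (axis i 1, 0)) ` (UNIV :: 'n set) \<union> (\<lambda>s. (0, Ind s)) ` S"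
  have card1: "card {s :: 'n set. card s = k} = CARD('n) choose k" for k
    using n_subsets[of "UNIV :: 'n set" k] by simp
  have "card W \<le> CARD('n) + card S"
    unfolding W_def by (rule order_trans[OF card_Un_le add_mono[OF card_image_le card_image_le]]) auto
  also have "card S \<le> CARD('n) + CARD('n) * (CARD('n) - 1) div 2"
    unfolding S_def using card_Un_le[of "{s :: 'n set. card s = 1}" "{s. card s = 2}"]
    by (simp add: card1 choose_two)
  also have "CARD('n) + CARD('n) * (CARD('n) - 1) div 2 = CARD('n) * (CARD('n) + 1) div 2"
  proof -
    obtain k where "CARD('n) = Suc k" using zero_less_card_finite gr0_implies_Suc by blast
    then show ?thesis by simp
  qed
  finally have "card W \<le> state_dim TYPE('n)" by (simp add: state_dim_def)
  moreover have "{(x :: real^'n, Y :: real^'n^'n). transpose Y = Y} \<subseteq> span W"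
  proof clarify
    fix x :: "real^'n" and Y :: "real^'n^'n" assume Y: "transpose Y = Y"
    have sym: "Y $ i $ j = Y $ j $ i" for i j
      using arg_cong[OF Y, of "\<lambda>Z. Z $ i $ j"] by (simp add: transpose_def)
    \<comment> \<open>The common value of the entries of \<open>Y\<close> at the positions \<open>(i, j)\<close> and \<open>(j, i)\<close> for \<open>s = {i, j}\<close>.\<close>
    define q where "q s = (SOME y. \<exists>i j. s = {i, j} \<and> y = Y $ i $ j)" for s
    have q: "q {i, j} = Y $ i $ j" for i j
      unfolding q_def by (rule some_equality) (auto simp: doubleton_eq_iff sym)
    have "{i, j} \<in> S" for i j by (cases "i = j") (auto simp: S_def)
    then have "(\<Sum>s\<in>S. q s *\<^sub>R Ind s) = Y"
      by (simp add: vec_eq_iff Ind_def q if_distrib sum.delta' cong: if_cong)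
    moreover have "(\<Sum>i\<in>UNIV. (x $ i) *\<^sub>R axis i 1) = x"
      using basis_expansion[of x] by (simp add: scalar_mult_eq_scaleR)
    ultimately have "(x, Y) = (\<Sum>i\<in>UNIV. (x $ i) *\<^sub>R (axis i 1, 0)) + (\<Sum>s\<in>S. q s *\<^sub>R (0, Ind s))"
      by (simp add: prod_eq_iff fst_sum snd_sum)
    moreover have "(\<Sum>i\<in>UNIV. (x $ i) *\<^sub>R (axis i 1, 0)) + (\<Sum>s\<in>S. q s *\<^sub>R (0, Ind s)) \<in> span W"
      by (intro span_add span_sum span_scale span_base) (auto simp: W_def)
    ultimately show "(x, Y) \<in> span W" by simp
  qed
  moreover have "finite W" by (simp add: W_def)
  ultimately show ?thesis using dim_le_card order_trans by blast
qed

section \<open>The rank condition on an open dense set\<close>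


lemma continuous_on_lifts:
  fixes V :: "(real^'n) set"
  assumes V: "open V" and "lifts V h H"
  shows "continuous_on (V \<times> sym_posdef) H"
proof -
  obtain R where h: "smooth_on V h" and R: "smooth_on V R"
    and H: "\<forall>X\<in>V \<times> sym_posdef. H X = lifted_field h R X"
    using assms(2) unfolding lifts_def by blast
  have "continuous_on (V \<times> sym_posdef) (lifted_field h R)"
  proof (intro continuous_at_imp_continuous_on ballI)
    fix X :: "(real^'n) \<times> (real^'n^'n)" assume "X \<in> V \<times> sym_posdef"
    then obtain m P where X: "X = (m, P)" and m: "m \<in> V" by auto
    show "isCont (lifted_field h R) X"
      unfolding X by (rule has_derivative_continuous[OF lifted_field_has_derivative[OF V h R m]])
  qed
  then show ?thesis
    by (rule continuous_on_eq) (simp add: H)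
qed

text \<open>Lifted fields have symmetric second component, so the dimension of the state space bounds
  their rank; full rank is therefore the same as rank at least \<^const>\<open>state_dim\<close>.\<close>

lemma dim_values_le:
  fixes V :: "(real^'n) set"
  assumes "\<forall>H\<in>\<H>. \<exists>h. lifts V h H" "X \<in> V \<times> sym_posdef"
  shows "dim {H X |H. H \<in> \<H>} \<le> state_dim TYPE('n)"
proof -
  have "{H X |H. H \<in> \<H>} \<subseteq> {(x, Y). transpose Y = Y}"
  proof clarify
    fix H x Y assume "H \<in> \<H>" and HX: "(x, Y) = H X"
    then obtain h R where R: "\<forall>m\<in>V. transpose (R m) = R m" "\<forall>X\<in>V \<times> sym_posdef. H X = lifted_field h R X"
      using assms(1) unfolding lifts_def by blast
    obtain m P where X: "X = (m, P)" "m \<in> V" "P \<in> sym_posdef" using assms(2) by auto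
    have "H X = lifted_field h R (m, P)" using R(2) assms(2) X(1) by blast
    with HX have "Y = jacobian h (at m) ** P + P ** transpose (jacobian h (at m)) + R m"
      by (simp add: lifted_field_def)
    then show "transpose Y = Y"
      using R(1) X(2) by (simp add: transpose_lin matrix_transpose_mul sym_posdef_transpose[OF X(3)] add.commute)
  qed
  then show ?thesis by (rule order_trans[OF dim_subset dim_symmetric_pairs])
qed

text \<open>Finitely many fields whose values form a basis at \<open>X0\<close> have independent values near \<open>X0\<close> by
  continuity.\<close>

lemma openin_full_rank:
  fixes V :: "(real^'n) set"
  assumes V: "open V" and l: "\<forall>H\<in>\<H>. \<exists>h. lifts V h H"
  defines "M \<equiv> V \<times> (sym_posdef :: (real^'n^'n) set)"
  shows "openin (top_of_set M) {X\<in>M. dim {H X |H. H \<in> \<H>} = state_dim TYPE('n)}" (is "openin _ ?W")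
proof (rule openin_subopen[THEN iffD2], rule ballI)
  fix X0 assume X0: "X0 \<in> ?W"
  obtain B where B: "B \<subseteq> {H X0 |H. H \<in> \<H>}" "independent B" "card B = dim {H X0 |H. H \<in> \<H>}"
    by (rule basis_exists)
  then have "\<forall>b\<in>B. \<exists>H\<in>\<H>. b = H X0" by blast
  then obtain K where K: "\<And>b. b \<in> B \<Longrightarrow> K b \<in> \<H>" "\<And>b. b \<in> B \<Longrightarrow> b = K b X0" by metis
  obtain c where c: "c \<ge> 0"
    "\<And>w. c * (\<Sum>b\<in>B. norm (w b - b)) < 1 \<Longrightarrow> \<exists>L. linear L \<and> inj L \<and> (\<forall>b\<in>B. L b = w b)"
    using independent_perturbation[OF B(2)] by blast
  \<comment> \<open>The function \<open>\<gamma>\<close> measures how far the values at \<open>X\<close> are from the basis at \<open>X0\<close>.\<close>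
  define \<gamma> where "\<gamma> X = c * (\<Sum>b\<in>B. norm (K b X - b))" for X
  have "continuous_on M (K b)" if "b \<in> B" for b
    unfolding M_def using K(1)[OF that] l continuous_on_lifts[OF V] by blast
  then have "continuous_on M \<gamma>"
    unfolding \<gamma>_def
    by (intro continuous_on_mult continuous_on_const continuous_on_sum continuous_on_norm continuous_on_diff)
  then have op: "openin (top_of_set M) (M \<inter> \<gamma> -` {..<1})"
    by (intro continuous_openin_preimage_gen) auto
  have "\<gamma> X0 = 0"
    unfolding \<gamma>_def using K(2) by (simp add: sum.neutral)
  then have "X0 \<in> M \<inter> \<gamma> -` {..<1}" using X0 by simp
  moreover have "M \<inter> \<gamma> -` {..<1} \<subseteq> ?W"
  proof
    fix X assume X: "X \<in> M \<inter> \<gamma> -` {..<1}"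
    then obtain L where L: "linear L" "inj L" "\<forall>b\<in>B. L b = K b X"
      using c(2)[of "\<lambda>b. K b X"] by (auto simp: \<gamma>_def)
    have "card B \<le> dim {H X |H. H \<in> \<H>}"
      by (rule card_le_dim_of_injection[OF B(2) L(1,2)]) (use L(3) K(1) in auto)
    moreover have "dim {H X |H. H \<in> \<H>} \<le> state_dim TYPE('n)"
      using dim_values_le[OF l] X by (simp add: M_def)
    ultimately show "X \<in> ?W" using X X0 B(3) by simp
  qed
  ultimately show "\<exists>T. openin (top_of_set M) T \<and> X0 \<in> T \<and> T \<subseteq> ?W" using op by blast
qed

text \<open>Over a fixed mean \<open>m\<close>, the values of the lifted fields are affine in the covariance. At a
  multiple \<open>I / s\<close> of the identity, and up to rescaling of the second component, they are the vectors
  of the assumed rank condition with the source terms added in the proportion \<open>s\<close>. This pencil is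
  injective at \<open>s = 0\<close>, hence at some \<open>s > 0\<close>. Along the segment from such a matrix to \<open>P0\<close>
  the values form a pencil of linear maps that is injective at its start, hence at all but finitely
  many points, in particular at points arbitrarily close to \<open>P0\<close>.\<close>

lemma full_rank_dense:
  fixes V :: "(real^'n) set"
  assumes V: "open V" and l: "\<forall>H\<in>\<H>. \<exists>h. lifts V h H"
    and L: "\<forall>h\<in>\<L>. \<exists>H\<in>\<H>. lifts V h H"
    and m: "m \<in> V" and P0: "P0 \<in> sym_posdef"
    and full: "dim {(h m, jacobian h (at m) + transpose (jacobian h (at m))) |h. h \<in> \<L>} = state_dim TYPE('n)"
  shows "(m, P0) \<in> closure {X\<in>V \<times> sym_posdef. dim {H X |H. H \<in> \<H>} = state_dim TYPE('n)}"
proof -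
  let ?J = "\<lambda>h. jacobian h (at m)"
  let ?S = "{(h m, ?J h + transpose (?J h)) |h. h \<in> \<L>}"
  obtain B where B: "B \<subseteq> ?S" "independent B" "card B = dim ?S"
    by (rule basis_exists)
  have "\<forall>b\<in>B. \<exists>h H r. H \<in> \<H> \<and> b = (h m, ?J h + transpose (?J h)) \<and>
      (\<forall>P\<in>sym_posdef. H (m, P) = (h m, ?J h ** P + P ** transpose (?J h) + r))"
  proof
    fix b assume "b \<in> B"
    then obtain h where h: "h \<in> \<L>" "b = (h m, ?J h + transpose (?J h))" using B(1) by blast
    then obtain H where H: "H \<in> \<H>" "lifts V h H" using L by blast
    then obtain R where "\<forall>X\<in>V \<times> sym_posdef. H X = lifted_field h R X" by (auto simp: lifts_def)
    then have "\<forall>P\<in>sym_posdef. H (m, P) = (h m, ?J h ** P + P ** transpose (?J h) + R m)"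
      using m by (simp add: lifted_field_def)
    then show "\<exists>h H r. H \<in> \<H> \<and> b = (h m, ?J h + transpose (?J h)) \<and>
      (\<forall>P\<in>sym_posdef. H (m, P) = (h m, ?J h ** P + P ** transpose (?J h) + r))" using h H by blast
  qed
  then obtain h K r where K: "\<And>b. b \<in> B \<Longrightarrow> K b \<in> \<H>"
    and b: "\<And>b. b \<in> B \<Longrightarrow> b = (h b m, ?J (h b) + transpose (?J (h b)))"
    and Kv: "\<And>b P. b \<in> B \<Longrightarrow> P \<in> sym_posdef \<Longrightarrow>
        K b (m, P) = (h b m, ?J (h b) ** P + P ** transpose (?J (h b)) + r b)"
    by metis
  \<comment> \<open>At the covariance \<open>I / s\<close> the values are \<open>b + s (0, r b)\<close> with second component divided by \<open>s\<close>.\<close>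
  obtain T where T: "linear T" "\<And>b. b \<in> B \<Longrightarrow> T b = (0 :: real^'n, r b)"
    using linear_independent_extend[OF B(2), of "\<lambda>b. (0 :: real^'n, r b)"] by blast
  have "finite {s. \<not> inj (\<lambda>x. id x + s *\<^sub>R T x)}"
    by (rule finite_singular_pencil[OF linear_id inj_on_id T(1)])
  then have "infinite ({0<..} - {s :: real. \<not> inj (\<lambda>x. id x + s *\<^sub>R T x)})"
    by (simp add: Diff_infinite_finite infinite_Ioi)
  then have "{0<..} - {s :: real. \<not> inj (\<lambda>x. id x + s *\<^sub>R T x)} \<noteq> {}"
    using finite.emptyI by metis
  then obtain s where s: "s > 0" and injs: "inj (\<lambda>x. id x + s *\<^sub>R T x)" by blast
  define P1 where "P1 = (1 / s) *\<^sub>R (mat 1 :: real^'n^'n)"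
  have P1: "P1 \<in> sym_posdef" using s by (simp add: P1_def sym_posdef_scaleR sym_posdef_identity)
  define C where "C x = (fst (x + s *\<^sub>R T x), (1 / s) *\<^sub>R snd (x + s *\<^sub>R T x))" for x
  have linC: "linear C"
    by (rule linearI) (simp_all add: C_def linear_add[OF T(1)] linear_scale[OF T(1)] algebra_simps)
  have injC: "inj C"
  proof (rule injI)
    fix x y assume "C x = C y"
    then have "x + s *\<^sub>R T x = y + s *\<^sub>R T y" using s by (simp add: C_def prod_eq_iff)
    then have "id x + s *\<^sub>R T x = id y + s *\<^sub>R T y" by simp
    then show "x = y" by (rule injD[OF injs])
  qed
  have C: "C b = K b (m, P1)" if "b \<in> B" for b
  proof -
    have "fst b = h b m"
      using arg_cong[OF b[OF that], of fst] by (simp only: fst_conv)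
    moreover have "snd b = ?J (h b) + transpose (?J (h b))"
      using arg_cong[OF b[OF that], of snd] by (simp only: snd_conv)
    moreover have "C b = (fst b, (1 / s) *\<^sub>R snd b + r b)"
      using s by (simp add: C_def T(2)[OF that] scaleR_add_right)
    ultimately show ?thesis
      unfolding Kv[OF that P1] by (simp add: P1_def matrix_mult_lin scaleR_add_right)
  qed
  \<comment> \<open>\<open>C + t D\<close> maps \<open>b\<close> to the value of its lift at \<open>P1 + t (P0 - P1)\<close>.\<close>
  obtain D where D: "linear D" "\<And>b. b \<in> B \<Longrightarrow> D b = K b (m, P0) - K b (m, P1)"
    using linear_independent_extend[OF B(2), of "\<lambda>b. K b (m, P0) - K b (m, P1)"] by blast
  let ?P = "\<lambda>t. P1 + t *\<^sub>R (P0 - P1)"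
  have good: "dim {H (m, ?P t) |H. H \<in> \<H>} = state_dim TYPE('n)"
    if "0 < t" "t < 1" "inj (\<lambda>x. C x + t *\<^sub>R D x)" for t
  proof -
    have Pt: "?P t \<in> sym_posdef" using sym_posdef_segment[OF P1 P0 that(1,2)] .
    have lin: "linear (\<lambda>x. C x + t *\<^sub>R D x)"
      using linC D(1) by (intro linear_compose_add linear_compose_scale_right)
    have "C b + t *\<^sub>R D b = K b (m, ?P t)" if "b \<in> B" for b
      unfolding C[OF that] D(2)[OF that] Kv[OF that Pt] Kv[OF that P0] Kv[OF that P1]
      by (simp add: matrix_mult_lin algebra_simps)
    then have "card B \<le> dim {H (m, ?P t) |H. H \<in> \<H>}"
      by (intro card_le_dim_of_injection[OF B(2) lin that(3)]) (use K in auto)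
    then show ?thesis
      using dim_values_le[OF l, of "(m, ?P t)"] m Pt B(3) full by simp
  qed
  have fin: "finite {t. \<not> inj (\<lambda>x. C x + t *\<^sub>R D x)}"
    by (rule finite_singular_pencil[OF linC injC D(1)])
  show ?thesis
    unfolding closure_approachable
  proof (intro allI impI)
    fix e :: real assume e: "e > 0"
    define d where "d = norm (P0 - P1) + 1"
    have d: "d > 0" by (simp add: d_def add_nonneg_pos)
    have "max 0 (1 - e / d) < 1" using e d by simp
    then have "infinite ({max 0 (1 - e / d)<..<1} - {t. \<not> inj (\<lambda>x. C x + t *\<^sub>R D x)})"
      using fin by (simp add: Diff_infinite_finite infinite_Ioo)
    then have "{max 0 (1 - e / d)<..<1} - {t. \<not> inj (\<lambda>x. C x + t *\<^sub>R D x)} \<noteq> {}"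
      using finite.emptyI by metis
    then obtain t where "t \<in> {max 0 (1 - e / d)<..<1}" and injt: "inj (\<lambda>x. C x + t *\<^sub>R D x)" by blast
    then have t: "0 < t" "t < 1" "1 - t < e / d" by auto
    have "?P t - P0 = (1 - t) *\<^sub>R (P1 - P0)" by (simp add: algebra_simps)
    then have "dist (m, ?P t) (m, P0) = (1 - t) * norm (P0 - P1)"
      using t by (simp add: dist_Pair_Pair dist_norm norm_minus_commute)
    also have "\<dots> \<le> (1 - t) * d" using t by (simp add: d_def)
    also have "\<dots> < e" using t(3) d by (simp add: pos_less_divide_eq)
    finally show "\<exists>X\<in>{X\<in>V \<times> sym_posdef. dim {H X |H. H \<in> \<H>} = state_dim TYPE('n)}. dist X (m, P0) < e"
      using good[OF t(1,2) injt] m sym_posdef_segment[OF P1 P0 t(1,2)] by (intro bexI[of _ "(m, ?P t)"]) auto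
  qed
qed

lemma full_rank_open_dense:
  fixes V :: "(real^'n) set"
  assumes V: "open V" and l: "\<forall>H\<in>\<H>. \<exists>h. lifts V h H"
    and L: "\<forall>h\<in>\<L>. \<exists>H\<in>\<H>. lifts V h H"
    and full: "\<forall>m\<in>V. dim {(h m, jacobian h (at m) + transpose (jacobian h (at m))) |h. h \<in> \<L>} = state_dim TYPE('n)"
  defines "M \<equiv> V \<times> (sym_posdef :: (real^'n^'n) set)"
  shows "\<exists>W. openin (top_of_set M) W \<and> M \<subseteq> closure W \<and>
    (\<forall>X\<in>W. dim {H X |H. H \<in> \<H>} = state_dim TYPE('n))"
proof (intro exI conjI)
  let ?W = "{X\<in>M. dim {H X |H. H \<in> \<H>} = state_dim TYPE('n)}"
  show "openin (top_of_set M) ?W" unfolding M_def by (rule openin_full_rank[OF V l])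
  show "M \<subseteq> closure ?W"
    unfolding M_def using full_rank_dense[OF V l L] full by auto
qed auto

section \<open>Lie algebra and zero-time ideal of the lifted family\<close>


lemma lifts_mean_cov_field:
  fixes f :: "(real^'n) \<times> (real^'u) \<Rightarrow> real^'n" and g :: "real^'n \<Rightarrow> real^'d^'n"
  assumes f: "smooth_on UNIV f" and g: "smooth_on UNIV g" and V: "open V"
  shows "lifts V (\<lambda>x. f (x, u)) (mean_cov_field f g u)"
  unfolding lifts_def
proof (intro conjI exI ballI)
  have gV: "smooth_on V g" using g Ck_on_subset[OF _ subset_UNIV] by (auto simp: smooth_on_def)
  show "smooth_on V (\<lambda>x. f (x, u))" using f Ck_on_fix_snd[OF V] by (auto simp: smooth_on_def)
  show "smooth_on V (\<lambda>m. g m ** transpose (g m))"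
    by (rule smooth_on_bilinear[OF V bounded_bilinear_matrix_mult gV smooth_on_linear[OF V bounded_linear_transpose gV]])
  show "transpose (g m ** transpose (g m)) = g m ** transpose (g m)" for m
    by (simp add: matrix_transpose_mul)
  show "mean_cov_field f g u X = lifted_field (\<lambda>x. f (x, u)) (\<lambda>m. g m ** transpose (g m)) X" for X
    by (simp add: mean_cov_field_def lifted_field_def Let_def)
qed

lemma list_of_parameters:
  assumes "set hs \<subseteq> {\<phi> u |u. u \<in> U}"
  obtains us where "set us \<subseteq> U" "hs = map \<phi> us"
proof -
  have "hs \<in> lists (\<phi> ` U)" using assms by auto
  then show ?thesis using that by (auto simp: lists_image)
qed

text \<open>Nested brackets of the two families with the same parameters correspond to each other, and both
  spans are taken over corresponding generators.\<close>

lemma lifted_families: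
  fixes V :: "(real^'n) set" and U :: "'u set"
  assumes V: "open V" and l: "\<And>u. u \<in> U \<Longrightarrow> lifts V (\<phi> u) (\<Phi> u)"
  defines "\<ff> \<equiv> {\<phi> u |u. u \<in> U}" and "\<FF> \<equiv> {\<Phi> u |u. u \<in> U}"
    and "M \<equiv> V \<times> (sym_posdef :: (real^'n^'n) set)"
  shows "\<forall>h\<in>Lie V \<ff>. \<exists>H\<in>Lie M \<FF>. lifts V h H"
    and "\<forall>H\<in>Lie M \<FF>. \<exists>h. lifts V h H"
    and "\<forall>h\<in>zero_time_ideal V \<ff>. \<exists>H\<in>zero_time_ideal M \<FF>. lifts V h H"
    and "\<forall>H\<in>zero_time_ideal M \<FF>. \<exists>h. lifts V h H"
proof -
  have br: "lifts V (nested_bracket V (map \<phi> us)) (nested_bracket M (map \<Phi> us))"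
    if "set us \<subseteq> U" "us \<noteq> []" for us
    unfolding M_def using that l by (intro lifts_nested_bracket[OF V]) auto
  have df: "lifts V (\<phi> u - \<phi> w) (\<Phi> u - \<Phi> w)" if "u \<in> U" "w \<in> U" for u w
    using lifts_linear_combination[OF V l[OF that(1)] l[OF that(2)], of 1 "-1"] by simp
  have down: "\<exists>H\<in>{nested_bracket M hs |hs. length hs \<ge> k \<and> set hs \<subseteq> \<FF>}. lifts V h H"
    if h: "h \<in> {nested_bracket V hs |hs. length hs \<ge> k \<and> set hs \<subseteq> \<ff>}" and k: "k \<ge> 1" for h k
  proof -
    obtain hs where hs: "h = nested_bracket V hs" "length hs \<ge> k" "set hs \<subseteq> \<ff>" using h by blast
    obtain us where us: "set us \<subseteq> U" "hs = map \<phi> us"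
      using list_of_parameters[OF hs(3)[unfolded \<ff>_def]] by blast
    have "lifts V h (nested_bracket M (map \<Phi> us))"
      unfolding hs(1) us(2) using hs(2) k us by (intro br) auto
    moreover have "length (map \<Phi> us) \<ge> k" "set (map \<Phi> us) \<subseteq> \<FF>" using hs us by (auto simp: \<FF>_def)
    ultimately show ?thesis by blast
  qed
  have up: "\<exists>h. lifts V h H"
    if H: "H \<in> {nested_bracket M hs |hs. length hs \<ge> k \<and> set hs \<subseteq> \<FF>}" and k: "k \<ge> 1" for H k
  proof -
    obtain hs where hs: "H = nested_bracket M hs" "length hs \<ge> k" "set hs \<subseteq> \<FF>" using H by blast
    obtain us where us: "set us \<subseteq> U" "hs = map \<Phi> us"
      using list_of_parameters[OF hs(3)[unfolded \<FF>_def]] by blast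
    show ?thesis using br[OF us(1)] hs(1,2) us(2) k by force
  qed
  show "\<forall>h\<in>Lie V \<ff>. \<exists>H\<in>Lie M \<FF>. lifts V h H"
    unfolding Lie_def using lifts_span[OF V down[of _ 1]] by blast
  show "\<forall>H\<in>Lie M \<FF>. \<exists>h. lifts V h H"
    unfolding Lie_def using lifts_span_converse[OF V up[of _ 1]] by blast
  let ?G = "{h1 - h2 |h1 h2. h1 \<in> \<ff> \<and> h2 \<in> \<ff>} \<union> derived_brackets V \<ff>"
  let ?G' = "{h1 - h2 |h1 h2. h1 \<in> \<FF> \<and> h2 \<in> \<FF>} \<union> derived_brackets M \<FF>"
  have G: "\<exists>H\<in>?G'. lifts V h H" if "h \<in> ?G" for h
    using that
  proof
    assume "h \<in> {h1 - h2 |h1 h2. h1 \<in> \<ff> \<and> h2 \<in> \<ff>}"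
    then obtain u w where uw: "u \<in> U" "w \<in> U" and h: "h = \<phi> u - \<phi> w" by (auto simp: \<ff>_def)
    have "\<Phi> u - \<Phi> w \<in> ?G'" using uw by (auto simp: \<FF>_def)
    then show ?thesis using df[OF uw] h by blast
  next
    assume "h \<in> derived_brackets V \<ff>"
    then show ?thesis using down[of h 2] unfolding derived_brackets_def by auto
  qed
  have G': "\<exists>h. lifts V h H" if "H \<in> ?G'" for H
    using that
  proof
    assume "H \<in> {h1 - h2 |h1 h2. h1 \<in> \<FF> \<and> h2 \<in> \<FF>}"
    then obtain u w where uw: "u \<in> U" "w \<in> U" and h: "H = \<Phi> u - \<Phi> w" by (auto simp: \<FF>_def)
    then show ?thesis using df[OF uw] by blast
  next
    assume "H \<in> derived_brackets M \<FF>"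
    then show ?thesis using up[of H 2] unfolding derived_brackets_def by auto
  qed
  show "\<forall>h\<in>zero_time_ideal V \<ff>. \<exists>H\<in>zero_time_ideal M \<FF>. lifts V h H"
    unfolding zero_time_ideal_def using lifts_span[OF V G] by blast
  show "\<forall>H\<in>zero_time_ideal M \<FF>. \<exists>h. lifts V h H"
    unfolding zero_time_ideal_def using lifts_span_converse[OF V G'] by blast
qed

theorem proposition2p12:
  fixes f :: "(real^'n) \<times> (real^'u) \<Rightarrow> real^'n"
    and g :: "real^'n \<Rightarrow> real^'d^'n"
    and V :: "(real^'n) set"
    and U :: "(real^'u) set"
  assumes "smooth_on UNIV f"
    and "smooth_on UNIV g"
    and "open V"
  defines "\<ff> \<equiv> {(\<lambda>x. f (x, u)) |u. u \<in> U}"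
    and "\<FF> \<equiv> {mean_cov_field f g u |u. u \<in> U}"
    and "M \<equiv> V \<times> (sym_posdef :: (real^'n^'n) set)"
  shows "((\<forall>m\<in>V. dim {(h m, jacobian h (at m) + transpose (jacobian h (at m))) |h. h \<in> Lie V \<ff>}
             = state_dim TYPE('n)) \<longrightarrow>
          (\<exists>W. openin (top_of_set M) W \<and> M \<subseteq> closure W \<and>
               (\<forall>X\<in>W. accessibility_rank M \<FF> X))) \<and>
         ((\<forall>m\<in>V. dim {(h m, jacobian h (at m) + transpose (jacobian h (at m))) |h. h \<in> zero_time_ideal V \<ff>}
             = state_dim TYPE('n)) \<longrightarrow>
          (\<exists>W. openin (top_of_set M) W \<and> M \<subseteq> closure W \<and>
               (\<forall>X\<in>W. accessibility_rank_fixed_time M \<FF> X)))"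
proof -
  note fam = lifted_families[where \<phi> = "\<lambda>u x. f (x, u)" and \<Phi> = "mean_cov_field f g" and U = U,
      OF \<open>open V\<close> lifts_mean_cov_field[OF assms(1-3)], folded \<ff>_def \<FF>_def M_def]
  show ?thesis
    unfolding accessibility_rank_def accessibility_rank_fixed_time_def
    by (intro conjI impI full_rank_open_dense[OF \<open>open V\<close> fam(2,1), folded M_def]
        full_rank_open_dense[OF \<open>open V\<close> fam(4,3), folded M_def])
qed

end
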